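(* Let $G$ be a finitely generated recursively presented group, $H\leq G$ a finitely generated subgroup and $A$ a finite alphabet. If $X\subset A^G$ is an effectively closed subshift, then its $H$-projective subdynamics $\pi_H(X)\subset A^H$ is an effectively closed subshift on $H$.
   Context: Let $K$ be a finitely generated group with finite generating set $S$ closed under inverses and containing $1_K$; words in $S^*$ represent elements of $K$. $K$ is recursively presented if it has a presentation $\langle S\mid R\rangle$ with $S$ finite and $R\subset S^*$ recursively enumerable. For a finite alphabet $A$, $A^K$ has the product topology and left shift action $(\sigma_g x)_h=x_{g^{-1}h}$; a subshift is a closed shift-invariant subset. Put $[a]_g=\{x\in A^K:x_g=a\}$. A pattern coding over $A$ is a finite set $c$ of pairs $(w,a)$ with $w\in S^*$, $a\in A$. For a set $\mathcal C$ of pattern codings, $X_{\mathcal C}=\bigcap_{g\in K,\,c\in\mathcal C}\big(A^K\setminus\bigcap_{(w,a)\in c}[a]_{gw}\big)$. $X\subset A^K$ is effectively closed if $X=X_{\mathcal C}$ for some recursively enumerable set $\mathcal C$ of pattern codings over $A$ (this does not depend on the choice of $S$). For $H\le G$ and a subshift $X\subset A^G$, $\pi_H(X)=\{x\in A^H:\exists y\in X,\ \forall h\in H,\ x_h=y_h\}$. *)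

theory Defs
  imports
    "HOL-Analysis.Function_Topology"
    "HOL-Algebra.Generated_Groups"
    "HOL-Library.Nat_Bijection"
begin

section \<open>Recursive functions and recursively enumerable sets\<close>

text \<open>The class of (total) recursive functions of Goedel and Kleene: the least class containing the
  basic functions and closed under composition, primitive recursion and minimization of regular
  functions. An \<open>n\<close>-ary function takes a list of length \<open>n\<close>; its values on lists of other
  lengths are irrelevant.\<close>

inductive recursive_fun :: "nat \<Rightarrow> (nat list \<Rightarrow> nat) \<Rightarrow> bool" where
  zero: "recursive_fun n (\<lambda>_. 0)"
| succ: "recursive_fun 1 (\<lambda>xs. Suc (hd xs))"
| proj: "i < n \<Longrightarrow> recursive_fun n (\<lambda>xs. xs ! i)"
| comp: "recursive_fun (length gs) f \<Longrightarrow> \<forall>g\<in>set gs. recursive_fun n g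
    \<Longrightarrow> recursive_fun n (\<lambda>xs. f (map (\<lambda>g. g xs) gs))"
| prec: "recursive_fun n f \<Longrightarrow> recursive_fun (Suc (Suc n)) g
    \<Longrightarrow> recursive_fun (Suc n) (\<lambda>xs. rec_nat (f (tl xs)) (\<lambda>k r. g (k # r # tl xs)) (hd xs))"
| minim: "recursive_fun (Suc n) g \<Longrightarrow> \<forall>xs. length xs = n \<longrightarrow> (\<exists>y. g (y # xs) = 0)
    \<Longrightarrow> recursive_fun n (\<lambda>xs. LEAST y. g (y # xs) = 0)"

definition re_set :: "nat set \<Rightarrow> bool" where
  "re_set M \<longleftrightarrow> M = {} \<or> (\<exists>f. recursive_fun 1 f \<and> M = range (\<lambda>n. f [n]))"

text \<open>Recursive enumerability of a set of words over a finite alphabet \<open>T\<close> refers to a numbering of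
  the letters; as \<open>T\<close> is finite, any two numberings differ by a finite table, so the choice is
  immaterial.\<close>

definition re_words :: "'t set \<Rightarrow> 't list set \<Rightarrow> bool" where
  "re_words T L \<longleftrightarrow> L \<subseteq> lists T \<and>
     (\<exists>e. inj_on e T \<and> re_set ((\<lambda>w. list_encode (map e w)) ` L))"


section \<open>Presentations and generating sets\<close>

text \<open>A letter \<open>(s, True)\<close> stands for the generator \<open>s\<close> and \<open>(s, False)\<close> for its formal inverse.
  The relation below is the congruence on words whose classes are the elements of the quotient of
  the free group on \<open>S\<close> by the normal closure of \<open>R\<close>.\<close>

inductive pres_eq :: "'s set \<Rightarrow> ('s \<times> bool) list set \<Rightarrow> ('s \<times> bool) list \<Rightarrow> ('s \<times> bool) list \<Rightarrow> bool"
  for S R where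
  refl: "u \<in> lists (S \<times> UNIV) \<Longrightarrow> pres_eq S R u u"
| sym: "pres_eq S R u v \<Longrightarrow> pres_eq S R v u"
| trans: "pres_eq S R u v \<Longrightarrow> pres_eq S R v w \<Longrightarrow> pres_eq S R u w"
| cancel: "u \<in> lists (S \<times> UNIV) \<Longrightarrow> v \<in> lists (S \<times> UNIV) \<Longrightarrow> s \<in> S
    \<Longrightarrow> pres_eq S R (u @ [(s, b), (s, \<not> b)] @ v) (u @ v)"
| relator: "u \<in> lists (S \<times> UNIV) \<Longrightarrow> v \<in> lists (S \<times> UNIV) \<Longrightarrow> r \<in> R
    \<Longrightarrow> pres_eq S R (u @ r @ v) (u @ v)"

definition presented_group :: "'s set \<Rightarrow> ('s \<times> bool) list set \<Rightarrow> ('s \<times> bool) list set monoid" where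
  "presented_group S R =
     \<lparr> carrier = lists (S \<times> UNIV) // {(u, v). pres_eq S R u v},
       mult = (\<lambda>P Q. \<Union>u\<in>P. \<Union>v\<in>Q. {w. pres_eq S R (u @ v) w}),
       one = {w. pres_eq S R [] w} \<rparr>"

text \<open>Generators are abstract symbols, without loss of generality natural numbers, and relators
  may contain formal inverses of generators. Presentations whose generators form a subset
  of the group closed under inverses, with relators that are words in these generators, are covered
  after renaming the generators.\<close>

definition recursively_presented :: "('g, 'm) monoid_scheme \<Rightarrow> bool" where
  "recursively_presented K \<longleftrightarrow>
     (\<exists>(S :: nat set) R. finite S \<and> re_words (S \<times> UNIV) R \<and> K \<cong> presented_group S R)"

definition fin_gen_set :: "('g, 'm) monoid_scheme \<Rightarrow> 'g set \<Rightarrow> bool" where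
  "fin_gen_set K S \<longleftrightarrow> finite S \<and> S \<subseteq> carrier K \<and> generate K S = carrier K
     \<and> \<one>\<^bsub>K\<^esub> \<in> S \<and> (\<forall>s\<in>S. inv\<^bsub>K\<^esub> s \<in> S)"

definition word_value :: "('g, 'm) monoid_scheme \<Rightarrow> 'g list \<Rightarrow> 'g" where
  "word_value K w = foldr (\<lambda>s g. s \<otimes>\<^bsub>K\<^esub> g) w \<one>\<^bsub>K\<^esub>"


section \<open>Subshifts\<close>

definition full_shift :: "('g, 'm) monoid_scheme \<Rightarrow> 'a set \<Rightarrow> ('g \<Rightarrow> 'a) set" where
  "full_shift K A = carrier K \<rightarrow>\<^sub>E A"

definition shift :: "('g, 'm) monoid_scheme \<Rightarrow> 'g \<Rightarrow> ('g \<Rightarrow> 'a) \<Rightarrow> ('g \<Rightarrow> 'a)" where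
  "shift K g x = (\<lambda>h\<in>carrier K. x (inv\<^bsub>K\<^esub> g \<otimes>\<^bsub>K\<^esub> h))"

definition subshift :: "('g, 'm) monoid_scheme \<Rightarrow> 'a set \<Rightarrow> ('g \<Rightarrow> 'a) set \<Rightarrow> bool" where
  "subshift K A X \<longleftrightarrow>
     closedin (product_topology (\<lambda>_. discrete_topology A) (carrier K)) X
     \<and> (\<forall>g\<in>carrier K. shift K g ` X \<subseteq> X)"

definition cylinder :: "('g, 'm) monoid_scheme \<Rightarrow> 'a set \<Rightarrow> 'a \<Rightarrow> 'g \<Rightarrow> ('g \<Rightarrow> 'a) set" where
  "cylinder K A a g = {x \<in> full_shift K A. x g = a}"

definition pattern_coding :: "'g set \<Rightarrow> 'a set \<Rightarrow> ('g list \<times> 'a) set \<Rightarrow> bool" where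
  "pattern_coding S A c \<longleftrightarrow> finite c \<and> c \<subseteq> lists S \<times> A"

text \<open>As for words, the numberings of the finite sets \<open>S\<close> and \<open>A\<close> are immaterial.\<close>

definition re_codings :: "'g set \<Rightarrow> 'a set \<Rightarrow> ('g list \<times> 'a) set set \<Rightarrow> bool" where
  "re_codings S A \<C> \<longleftrightarrow> (\<forall>c\<in>\<C>. pattern_coding S A c) \<and>
     (\<exists>e d. inj_on e S \<and> inj_on d A \<and>
        re_set ((\<lambda>c. set_encode ((\<lambda>(w, a). prod_encode (list_encode (map e w), d a)) ` c)) ` \<C>))"

text \<open>The intersections with \<^term>\<open>full_shift K A\<close> make empty intersections mean the whole
  configuration space.\<close>

definition shift_avoiding ::
    "('g, 'm) monoid_scheme \<Rightarrow> 'a set \<Rightarrow> ('g list \<times> 'a) set set \<Rightarrow> ('g \<Rightarrow> 'a) set" where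
  "shift_avoiding K A \<C> = full_shift K A \<inter>
     (\<Inter>g\<in>carrier K. \<Inter>c\<in>\<C>. full_shift K A -
        (full_shift K A \<inter> (\<Inter>(w, a)\<in>c. cylinder K A a (g \<otimes>\<^bsub>K\<^esub> word_value K w))))"

definition effectively_closed ::
    "('g, 'm) monoid_scheme \<Rightarrow> 'g set \<Rightarrow> 'a set \<Rightarrow> ('g \<Rightarrow> 'a) set \<Rightarrow> bool" where
  "effectively_closed K S A X \<longleftrightarrow> (\<exists>\<C>. re_codings S A \<C> \<and> X = shift_avoiding K A \<C>)"

definition proj_subdynamics :: "'g set \<Rightarrow> 'a set \<Rightarrow> ('g \<Rightarrow> 'a) set \<Rightarrow> ('g \<Rightarrow> 'a) set" where
  "proj_subdynamics H A X = {x \<in> H \<rightarrow>\<^sub>E A. \<exists>y\<in>X. \<forall>h\<in>H. x h = y h}"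

end

theory Submission
  imports Defs
begin

text \<open>
  Fix a numbering of a finite alphabet \<open>U\<close> that contains the generators \<open>S\<close> of \<open>G\<close> and
  \<open>T\<close> of \<open>H\<close>. The candidate for the forbidden pattern codings of \<open>\<pi>\<^sub>H(X)\<close> is the set \<open>\<D>\<close> of all
  codings \<open>c\<close> over \<open>T\<close> that no \<open>y \<in> X\<close> realises at the identity. Shift invariance of \<open>X\<close> shows
  that restrictions of elements of \<open>X\<close> avoid \<open>\<D>\<close>. Conversely, if every finite part of \<open>x\<close> is
  realised in \<open>X\<close>, then by compactness some \<open>y \<in> X\<close> extends all of \<open>x\<close>
  (\<open>proj_subdynamics_eq_shift_avoiding\<close>). It remains to see that \<open>\<D>\<close> is recursively enumerable.

  Both the compactness and the enumerability are reduced to propositional logic. For every word \<open>l\<close>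
  and every colour \<open>b\<close> there is a propositional variable ``the cell reached by \<open>l\<close> has colour
  \<open>b\<close>''. That an assignment comes from an element of \<open>X\<close> is expressed by clauses: each word has
  exactly one colour, words with the same value in \<open>G\<close> have the same colour, and no translate of a
  forbidden coding of \<open>X\<close> occurs (\<open>pattern_extension_as_satisfiability\<close>). The second
  requirement is imposed only along single rewriting steps of the presentation of \<open>G\<close>. Equality
  in \<open>G\<close> is the congruence generated by these steps, so they already force the colour to depend on the
  value alone, and the steps form a recursively enumerable relation because the presentation is
  recursive (\<open>recursively_enumerable_rewriting\<close>). Hence the clauses are recursively enumerable.

  A coding is realised in \<open>X\<close> iff the clauses together with its variables are
  satisfiable. By compactness unsatisfiability is witnessed at a finite stage: there is an \<open>n\<close> such
  that every assignment to the first \<open>n\<close> variables violates one of the clauses. Checking this is a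
  bounded quantifier over an enumerable property, so unsatisfiability is recursively enumerable
  (\<open>semidecidable_unsatisfiable\<close>), and \<open>\<D>\<close> is.

  The recursion theory used here consists of closure properties of unary predicates. Several arguments
  are packed with \<^const>\<open>prod_encode\<close>, so that a quantifier over a variable becomes a projection of
  the single argument, and membership of a concrete predicate in a class follows by backward
  chaining along its syntax.
\<close>

section \<open>Recursive functions of several arguments\<close>

text \<open>Values on lists of the wrong length are noise of the representation; this closes the class
  \<^const>\<open>recursive_fun\<close> under equality on the lists that matter, so that its members can be
  rewritten.\<close>

definition recf :: "nat \<Rightarrow> (nat list \<Rightarrow> nat) \<Rightarrow> bool" where
  "recf n f \<longleftrightarrow> (\<exists>f'. recursive_fun n f' \<and> (\<forall>xs. length xs = n \<longrightarrow> f' xs = f xs))"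

lemma recfI: "recursive_fun n f \<Longrightarrow> recf n f"
  by (auto simp: recf_def)

lemma recf_cong: "recf n f \<Longrightarrow> (\<And>xs. length xs = n \<Longrightarrow> f xs = g xs) \<Longrightarrow> recf n g"
  by (auto simp: recf_def)

lemma recf_comp:
  assumes "recf (length gs) f" "\<And>g. g \<in> set gs \<Longrightarrow> recf n g"
  shows "recf n (\<lambda>xs. f (map (\<lambda>g. g xs) gs))"
proof -
  obtain f' where f': "recursive_fun (length gs) f'" "\<And>xs. length xs = length gs \<Longrightarrow> f' xs = f xs"
    using assms(1) by (auto simp: recf_def)
  obtain R where R: "\<And>g. g \<in> set gs \<Longrightarrow> recursive_fun n (R g)"
    "\<And>g xs. g \<in> set gs \<Longrightarrow> length xs = n \<Longrightarrow> R g xs = g xs"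
    using assms(2) unfolding recf_def by metis
  have "recursive_fun n (\<lambda>xs. f' (map (\<lambda>g. g xs) (map R gs)))"
    by (rule recursive_fun.comp) (use f' R in auto)
  moreover have "f' (map (\<lambda>g. g xs) (map R gs)) = f (map (\<lambda>g. g xs) gs)"
    if "length xs = n" for xs
  proof -
    have "map (\<lambda>g. g xs) (map R gs) = map (\<lambda>g. g xs) gs"
      unfolding map_map comp_def using R(2)[OF _ that] by (rule map_cong[OF HOL.refl])
    then show ?thesis using f'(2)[of "map (\<lambda>g. g xs) gs"] by (simp del: map_map)
  qed
  ultimately show ?thesis
    unfolding recf_def by (intro exI[of _ "\<lambda>xs. f' (map (\<lambda>g. g xs) (map R gs))"] conjI allI impI)
qed

lemma recf_comp1: "recf 1 f \<Longrightarrow> recf n g \<Longrightarrow> recf n (\<lambda>xs. f [g xs])"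
  using recf_comp[of "[g]" f n] by simp

lemma recf_comp2: "recf 2 f \<Longrightarrow> recf n g \<Longrightarrow> recf n h \<Longrightarrow> recf n (\<lambda>xs. f [g xs, h xs])"
  using recf_comp[of "[g, h]" f n] by (auto simp: numeral_2_eq_2)

lemma recf_proj: "i < n \<Longrightarrow> recf n (\<lambda>xs. xs ! i)"
  by (intro recfI recursive_fun.proj)

lemma recf_Suc: "recf n f \<Longrightarrow> recf n (\<lambda>xs. Suc (f xs))"
  using recf_comp1[OF recfI[OF recursive_fun.succ]] by simp

lemma recf_const: "recf n (\<lambda>xs. c)"
  by (induction c) (auto intro: recf_Suc recfI recursive_fun.zero)

lemma recf_rec:
  assumes "recf n f" "recf (Suc (Suc n)) (\<lambda>ys. g (ys ! 0) (ys ! 1) (tl (tl ys)))"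
  shows "recf (Suc n) (\<lambda>xs. rec_nat (f (tl xs)) (\<lambda>k r. g k r (tl xs)) (hd xs))"
proof -
  obtain f' where f': "recursive_fun n f'" "\<And>xs. length xs = n \<Longrightarrow> f' xs = f xs"
    using assms(1) by (auto simp: recf_def)
  obtain g' where g': "recursive_fun (Suc (Suc n)) g'"
    "\<And>xs. length xs = Suc (Suc n) \<Longrightarrow> g' xs = g (xs ! 0) (xs ! 1) (tl (tl xs))"
    using assms(2) by (auto simp: recf_def)
  have "rec_nat (f' (tl xs)) (\<lambda>k r. g' (k # r # tl xs)) m
      = rec_nat (f (tl xs)) (\<lambda>k r. g k r (tl xs)) m" if "length xs = Suc n" for xs m
    using that by (induction m) (auto simp: f' g')
  then show ?thesis
    unfolding recf_def using recursive_fun.prec[OF f'(1) g'(1)] by blast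
qed

text \<open>Primitive recursion with one parameter, composed at once with arbitrary inner functions. All the
  arithmetic below is an instance of it.\<close>

lemma recf_rec2:
  assumes "recf 1 (\<lambda>xs. f (xs ! 0))" "recf 3 (\<lambda>ys. g (ys ! 0) (ys ! 1) (ys ! 2))"
    and "recf n b" "recf n a"
  shows "recf n (\<lambda>xs. rec_nat (f (a xs)) (\<lambda>k r. g k r (a xs)) (b xs))"
proof -
  have g: "recf (Suc (Suc 1)) (\<lambda>ys. g (ys ! 0) (ys ! 1) (tl (tl ys) ! 0))"
    by (rule recf_cong[where f = "\<lambda>ys. g (ys ! 0) (ys ! 1) (ys ! 2)"])
      (use assms(2) in \<open>auto simp: numeral_3_eq_3 numeral_2_eq_2 nth_tl\<close>)
  have "recf (Suc 1) (\<lambda>xs. rec_nat (f (tl xs ! 0)) (\<lambda>k r. g k r (tl xs ! 0)) (hd xs))"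
    using recf_rec[OF assms(1) g] .
  then have "recf n (\<lambda>xs. (\<lambda>xs. rec_nat (f (tl xs ! 0)) (\<lambda>k r. g k r (tl xs ! 0)) (hd xs)) [b xs, a xs])"
    by (intro recf_comp2 assms(3,4)) (simp add: numeral_2_eq_2)
  then show ?thesis by simp
qed

lemma recf_add:
  assumes "recf n f" "recf n g" shows "recf n (\<lambda>xs. f xs + g xs)"
proof -
  have "recf n (\<lambda>xs. rec_nat (f xs) (\<lambda>k r. Suc r) (g xs))"
    by (rule recf_rec2[where f = "\<lambda>x. x" and g = "\<lambda>k r x. Suc r"])
      (intro recf_proj recf_Suc assms; simp)+
  moreover have "rec_nat a (\<lambda>k r. Suc r) b = a + b" for a b :: nat by (induction b) auto
  ultimately show ?thesis by simp
qed

lemma recf_mult: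
  assumes "recf n f" "recf n g" shows "recf n (\<lambda>xs. f xs * g xs)"
proof -
  have "recf n (\<lambda>xs. rec_nat 0 (\<lambda>k r. f xs + r) (g xs))"
    by (rule recf_rec2[where f = "\<lambda>x. 0" and g = "\<lambda>k r x. x + r"])
      (intro recf_proj recf_add recf_const assms; simp)+
  moreover have "rec_nat 0 (\<lambda>k r. a + r) b = a * b" for a b :: nat by (induction b) auto
  ultimately show ?thesis by simp
qed

lemma recf_pred:
  assumes "recf n f" shows "recf n (\<lambda>xs. f xs - 1)"
proof -
  have "recf n (\<lambda>xs. rec_nat 0 (\<lambda>k r. k) (f xs))"
    by (rule recf_rec2[where f = "\<lambda>x. 0" and g = "\<lambda>k r x. k" and a = f])
      (intro recf_proj recf_const assms; simp)+
  moreover have "rec_nat 0 (\<lambda>k r. k) b = b - 1" for b :: nat by (induction b) auto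
  ultimately show ?thesis by simp
qed

lemma recf_diff:
  assumes "recf n f" "recf n g" shows "recf n (\<lambda>xs. f xs - g xs)"
proof -
  have "recf n (\<lambda>xs. rec_nat (f xs) (\<lambda>k r. r - 1) (g xs))"
    by (rule recf_rec2[where f = "\<lambda>x. x" and g = "\<lambda>k r x. r - 1"])
      (intro recf_proj recf_pred assms; simp)+
  moreover have "rec_nat a (\<lambda>k r. r - 1) b = a - b" for a b :: nat by (induction b) auto
  ultimately show ?thesis by simp
qed

lemma recf_triangle:
  assumes "recf n f" shows "recf n (\<lambda>xs. triangle (f xs))"
proof -
  have "recf n (\<lambda>xs. rec_nat 0 (\<lambda>k r. r + Suc k) (f xs))"
    by (rule recf_rec2[where f = "\<lambda>x. 0" and g = "\<lambda>k r x. r + Suc k" and a = f])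
      (intro recf_proj recf_const recf_add recf_Suc assms; simp)+
  moreover have "rec_nat 0 (\<lambda>k r. r + Suc k) b = triangle b" for b :: nat
    by (induction b) auto
  ultimately show ?thesis by simp
qed

lemma recf_Least:
  assumes "recf 2 (\<lambda>xs. f (xs ! 0) (xs ! 1))" "\<And>x. \<exists>y. f y x = 0"
  shows "recf 1 (\<lambda>xs. LEAST y. f y (xs ! 0) = 0)"
proof -
  obtain g where g: "recursive_fun 2 g" "\<And>xs. length xs = 2 \<Longrightarrow> g xs = f (xs ! 0) (xs ! 1)"
    using assms(1) unfolding recf_def by blast
  have *: "g (y # xs) = f y (xs ! 0)" if "length xs = 1" for y xs
    using that by (subst g(2)) auto
  have "recursive_fun 1 (\<lambda>xs. LEAST y. g (y # xs) = 0)"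
    by (rule recursive_fun.minim) (use g(1) assms(2) * in \<open>auto simp: numeral_2_eq_2\<close>)
  then show ?thesis
    unfolding recf_def using * by (intro exI conjI) auto
qed

section \<open>Computable functions and decidable predicates on numbers\<close>

text \<open>From here on all functions are unary. The single argument carries an environment, built with
  \<^const>\<open>prod_encode\<close>, and the variables are its projections.\<close>

definition computable :: "(nat \<Rightarrow> nat) \<Rightarrow> bool" where
  "computable f \<longleftrightarrow> recf 1 (\<lambda>xs. f (xs ! 0))"

lemma computable_recf: "computable f \<Longrightarrow> recf n g \<Longrightarrow> recf n (\<lambda>xs. f (g xs))"
  unfolding computable_def by (drule (1) recf_comp1) simp

lemma computable_id: "computable (\<lambda>x. x)"
  and computable_const: "computable (\<lambda>x. c)"
  and computable_Suc: "computable f \<Longrightarrow> computable (\<lambda>x. Suc (f x))"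
  and computable_add: "computable f \<Longrightarrow> computable g \<Longrightarrow> computable (\<lambda>x. f x + g x)"
  and computable_mult: "computable f \<Longrightarrow> computable g \<Longrightarrow> computable (\<lambda>x. f x * g x)"
  and computable_diff: "computable f \<Longrightarrow> computable g \<Longrightarrow> computable (\<lambda>x. f x - g x)"
  and computable_triangle: "computable f \<Longrightarrow> computable (\<lambda>x. triangle (f x))"
  unfolding computable_def
  by (auto intro: recf_proj recf_const recf_Suc recf_add recf_mult recf_diff recf_triangle)

lemma computable_comp: "computable f \<Longrightarrow> computable g \<Longrightarrow> computable (\<lambda>x. f (g x))"
  unfolding computable_def[of "\<lambda>x. f (g x)"] computable_def[of g] by (rule computable_recf)

lemma recf_prod_encode: "recf n f \<Longrightarrow> recf n g \<Longrightarrow> recf n (\<lambda>xs. prod_encode (f xs, g xs))"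
  unfolding prod_encode_def prod.case by (intro recf_add recf_triangle)

lemma computable_prod_encode:
  "computable f \<Longrightarrow> computable g \<Longrightarrow> computable (\<lambda>x. prod_encode (f x, g x))"
  unfolding computable_def by (rule recf_prod_encode)

abbreviation "pfst z \<equiv> fst (prod_decode z)"
abbreviation "psnd z \<equiv> snd (prod_decode z)"

text \<open>The pair coded by \<open>z\<close> lies on the diagonal \<open>k\<close> with \<open>triangle k \<le> z < triangle (k + 1)\<close>. The
  diagonal is found by minimization, which makes the projections computable.\<close>

lemma prod_decode_eq_root:
  fixes z :: nat
  defines "k \<equiv> LEAST k. Suc z - triangle (Suc k) = 0"
  shows "pfst z = z - triangle k" "psnd z = k - (z - triangle k)"
proof -
  obtain a b where z: "z = prod_encode (a, b)" by (metis prod_decode_inverse surj_pair)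
  have mono: "triangle (Suc m) \<le> triangle n" if "m < n" for m n
    using that by (induction n) (auto simp: less_Suc_eq)
  have "k = a + b"
    unfolding k_def
  proof (rule Least_equality)
    show "Suc z - triangle (Suc (a + b)) = 0" by (auto simp: z prod_encode_def)
  next
    fix m assume m: "Suc z - triangle (Suc m) = 0"
    show "a + b \<le> m"
    proof (rule ccontr)
      assume "\<not> a + b \<le> m"
      then have "triangle (Suc m) \<le> triangle (a + b)" by (intro mono) auto
      with m show False by (auto simp: z prod_encode_def)
    qed
  qed
  moreover have "pfst z = a" "psnd z = b" "z - triangle (a + b) = a"
    by (simp_all add: z) (simp add: prod_encode_def)
  ultimately show "pfst z = z - triangle k" "psnd z = k - (z - triangle k)"
    by simp_all
qed

lemma computable_pfst_psnd0: "computable pfst" "computable psnd"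
proof -
  have "recf 1 (\<lambda>xs. LEAST y. Suc (xs ! 0) - triangle (Suc y) = 0)"
  proof (rule recf_Least[where f = "\<lambda>y x. Suc x - triangle (Suc y)"])
    show "recf 2 (\<lambda>xs. Suc (xs ! 1) - triangle (Suc (xs ! 0)))"
      by (intro recf_diff recf_triangle recf_Suc recf_proj) auto
    have "x \<le> triangle x" for x by (induction x) auto
    then show "\<exists>y. Suc x - triangle (Suc y) = 0" for x
      by (metis diff_is_0_eq)
  qed
  then have k: "computable (\<lambda>x. LEAST y. Suc x - triangle (Suc y) = 0)"
    by (simp add: computable_def)
  show "computable pfst" "computable psnd"
    unfolding prod_decode_eq_root
    by (intro computable_diff computable_triangle computable_id k)+
qed

lemma computable_pfst: "computable f \<Longrightarrow> computable (\<lambda>x. pfst (f x))"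
  and computable_psnd: "computable f \<Longrightarrow> computable (\<lambda>x. psnd (f x))"
  using computable_comp[OF computable_pfst_psnd0(1)] computable_comp[OF computable_pfst_psnd0(2)]
  by auto

lemma computable_rec_nat:
  assumes "computable b" "computable c"
    and "computable (\<lambda>z. g (pfst z) (pfst (psnd z)) (psnd (psnd z)))"
  shows "computable (\<lambda>x. rec_nat (c x) (\<lambda>k r. g k r x) (b x))"
proof -
  have "recf 3 (\<lambda>ys. (\<lambda>z. g (pfst z) (pfst (psnd z)) (psnd (psnd z)))
      (prod_encode (ys ! 0, prod_encode (ys ! 1, ys ! 2))))"
    by (intro computable_recf[OF assms(3)] recf_prod_encode recf_proj) auto
  then have "recf 3 (\<lambda>ys. g (ys ! 0) (ys ! 1) (ys ! 2))" by simp
  from recf_rec2[OF _ this, of c 1 "\<lambda>xs. b (xs ! 0)" "\<lambda>xs. xs ! 0"] assms(1,2) show ?thesis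
    by (auto simp: computable_def intro: recf_proj)
qed

text \<open>Truth is the value \<open>0\<close>, the value for which minimization searches.\<close>

definition decidable :: "(nat \<Rightarrow> bool) \<Rightarrow> bool" where
  "decidable P \<longleftrightarrow> computable (\<lambda>x. if P x then 0 else 1)"

lemma decidableI:
  assumes "computable f" "\<And>x. f x = 0 \<longleftrightarrow> P x"
  shows "decidable P"
proof -
  have "computable (\<lambda>x. 1 - (1 - f x))"
    by (intro computable_diff computable_const assms)
  also have "(\<lambda>x. 1 - (1 - f x)) = (\<lambda>x. if P x then 0 else 1)"
  proof
    show "1 - (1 - f x) = (if P x then 0 else 1)" for x
      using assms(2)[of x] by (cases "f x") auto
  qed
  finally show ?thesis by (simp add: decidable_def)
qed

lemma decidable_not:
  assumes "decidable P" shows "decidable (\<lambda>x. \<not> P x)"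
  by (rule decidableI[OF computable_diff[OF computable_const[of 1] assms[unfolded decidable_def]]])
    simp

lemma decidable_conj:
  assumes "decidable P" "decidable Q" shows "decidable (\<lambda>x. P x \<and> Q x)"
  by (rule decidableI[OF computable_add[OF assms[unfolded decidable_def]]]) simp

lemma decidable_disj:
  assumes "decidable P" "decidable Q" shows "decidable (\<lambda>x. P x \<or> Q x)"
  by (rule decidableI[OF computable_mult[OF assms[unfolded decidable_def]]]) simp

lemma decidable_le:
  assumes "computable f" "computable g" shows "decidable (\<lambda>x. f x \<le> g x)"
  by (rule decidableI[OF computable_diff[OF assms]]) simp

lemma decidable_less:
  assumes "computable f" "computable g" shows "decidable (\<lambda>x. f x < g x)"
  using decidable_not[OF decidable_le[OF assms(2,1)]] by (simp add: not_le)

lemma decidable_eq: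
  assumes "computable f" "computable g" shows "decidable (\<lambda>x. f x = g x)"
  using decidable_conj[OF decidable_le[OF assms] decidable_le[OF assms(2,1)]]
  by (simp add: order_eq_iff)

lemma decidable_const: "decidable (\<lambda>x. b)"
  by (cases b) (auto simp: decidable_def intro: computable_const)

lemma decidable_finite_mem:
  assumes "finite F" "computable f" shows "decidable (\<lambda>x. f x \<in> F)"
  using assms(1)
proof (induction F)
  case empty
  then show ?case by (simp add: decidable_const)
next
  case (insert a F)
  then show ?case
    unfolding insert_iff by (intro decidable_disj decidable_eq computable_const assms(2))
qed

lemma decidable_comp: "decidable P \<Longrightarrow> computable f \<Longrightarrow> decidable (\<lambda>x. P (f x))"
  unfolding decidable_def by (rule computable_comp)

lemma computable_if:
  assumes "decidable P" "computable f" "computable g"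
  shows "computable (\<lambda>x. if P x then f x else g x)"
proof -
  have "computable (\<lambda>x. (1 - (if P x then 0 else 1)) * f x + (if P x then 0 else 1) * g x)"
    using assms by (intro computable_add computable_mult computable_diff computable_const)
      (auto simp: decidable_def)
  also have "\<dots> = (\<lambda>x. if P x then f x else g x)" by auto
  finally show ?thesis .
qed

lemma computable_Least:
  assumes "decidable (\<lambda>z. P (pfst z) (psnd z))" "\<And>x. \<exists>y. P y x"
  shows "computable (\<lambda>x. LEAST y. P y x)"
proof -
  let ?f = "\<lambda>y x. if P y x then 0 else 1::nat"
  have "recf 2 (\<lambda>xs. (\<lambda>z. ?f (pfst z) (psnd z)) (prod_encode (xs ! 0, xs ! 1)))"
    by (rule computable_recf[OF assms(1)[unfolded decidable_def]])
      (intro recf_prod_encode recf_proj; simp)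
  then have "recf 2 (\<lambda>xs. ?f (xs ! 0) (xs ! 1))" by simp
  moreover have "\<exists>y. ?f y x = 0" for x using assms(2)[of x] by auto
  ultimately have "recf 1 (\<lambda>xs. LEAST y. ?f y (xs ! 0) = 0)" by (rule recf_Least)
  moreover have "(?f y x = 0) = P y x" for x y by simp
  ultimately show ?thesis
    unfolding computable_def by (simp only:)
qed

text \<open>A bounded search is an unbounded one that stops at the bound: it ends before the bound iff it
  meets a witness.\<close>

lemma decidable_bex_less:
  assumes "computable b" "decidable (\<lambda>z. P (pfst z) (psnd z))"
  shows "decidable (\<lambda>x. \<exists>y<b x. P y x)"
proof -
  have "computable (\<lambda>x. LEAST y. b x \<le> y \<or> P y x)"
    by (intro computable_Least decidable_disj decidable_le assms(2) computable_pfst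
        computable_comp[OF assms(1)] computable_psnd computable_id) auto
  then have "decidable (\<lambda>x. (LEAST y. b x \<le> y \<or> P y x) < b x)"
    by (intro decidable_less assms(1))
  moreover have "(LEAST y. b x \<le> y \<or> P y x) < b x \<longleftrightarrow> (\<exists>y<b x. P y x)" for x
    by (metis (mono_tags, lifting) LeastI Least_le leD le_less_trans order_refl)
  ultimately show ?thesis by simp
qed

lemma decidable_ball_less:
  assumes "computable b" "decidable (\<lambda>z. P (pfst z) (psnd z))"
  shows "decidable (\<lambda>x. \<forall>y<b x. P y x)"
  using decidable_not[OF decidable_bex_less[OF assms(1) decidable_not[OF assms(2)]]] by simp

lemma computable_pow2:
  assumes "computable f" shows "computable (\<lambda>x. 2 ^ f x)"
proof -
  have "computable (\<lambda>x. rec_nat 1 (\<lambda>k r. 2 * r) (f x))"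
    by (intro computable_rec_nat computable_const assms computable_mult computable_pfst
        computable_psnd computable_id)
  moreover have "rec_nat 1 (\<lambda>k r. 2 * r) n = (2::nat) ^ n" for n by (induction n) auto
  ultimately show ?thesis by simp
qed

lemma decidable_mem_set_decode:
  assumes "computable f" "computable g" shows "decidable (\<lambda>x. f x \<in> set_decode (g x))"
proof -
  \<comment> \<open>the binary digit of \<open>n\<close> at \<open>i\<close> is 1 iff the quotient of \<open>n\<close> by \<open>2^i\<close> is some odd \<open>2 * q + 1\<close>\<close>
  have *: "i \<in> set_decode n \<longleftrightarrow> (\<exists>q<Suc n. (2 * q + 1) * 2 ^ i \<le> n \<and> n < (2 * q + 2) * 2 ^ i)"
    (is "?L = ?R") for i n
  proof
    assume ?L
    then obtain q where q: "n div 2 ^ i = 2 * q + 1"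
      by (auto simp: set_decode_def elim: oddE)
    have "(2 * q + 1) * 2 ^ i \<le> n" using q by (metis div_times_less_eq_dividend)
    moreover have "n < (2 * q + 2) * 2 ^ i"
      using q by (metis add_2_eq_Suc' add.commute div_less_iff_less_mult lessI Suc_1 add_Suc_right
          pos2 zero_less_power plus_1_eq_Suc)
    moreover have "q < Suc n" using q by (metis div_le_dividend less_Suc_eq_le le_add1 mult_2 add.assoc le_trans)
    ultimately show ?R by blast
  next
    assume ?R
    then obtain q where "(2 * q + 1) * 2 ^ i \<le> n" "n < (2 * q + 2) * 2 ^ i" by blast
    then have "n div 2 ^ i = 2 * q + 1"
      by (intro div_nat_eqI) (auto simp: algebra_simps)
    then show ?L by (simp add: set_decode_def)
  qed
  show ?thesis
    unfolding *
    by (intro decidable_bex_less decidable_conj decidable_le decidable_less computable_mult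
        computable_add computable_const computable_pow2 computable_pfst computable_psnd
        computable_Suc computable_id computable_comp[OF assms(1)] computable_comp[OF assms(2)] assms)
qed

text \<open>This turns quantification over a coded finite set into bounded quantification.\<close>

lemma set_decode_less: "i \<in> set_decode n \<Longrightarrow> i < n"
  by (metis div_less even_zero less_exp less_trans not_less_iff_gr_or_eq set_decode_def mem_Collect_eq)

lemma decidable_ball_set_decode:
  assumes "computable f" "decidable (\<lambda>z. P (pfst z) (psnd z))"
  shows "decidable (\<lambda>x. \<forall>i\<in>set_decode (f x). P i x)"
proof -
  have "(\<forall>i\<in>set_decode (f x). P i x) \<longleftrightarrow> (\<forall>i<f x. i \<notin> set_decode (f x) \<or> P i x)" for x
    using set_decode_less by blast
  then show ?thesis
    by (simp only:) (intro decidable_ball_less decidable_disj decidable_not decidable_mem_set_decode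
        computable_pfst computable_psnd computable_id computable_comp[OF assms(1)] assms)
qed

lemma decidable_bex_set_decode:
  assumes "computable f" "decidable (\<lambda>z. P (pfst z) (psnd z))"
  shows "decidable (\<lambda>x. \<exists>i\<in>set_decode (f x). P i x)"
  using decidable_not[OF decidable_ball_set_decode[OF assms(1) decidable_not[OF assms(2)]]] by simp

lemmas computable_intros = computable_id computable_const computable_Suc computable_add
  computable_mult computable_diff computable_prod_encode computable_pfst computable_psnd
  computable_pow2 computable_if

section \<open>Recursively enumerable sets as semidecidable predicates\<close>

text \<open>Projections of decidable relations treat the empty predicate like any other, and closure under
  conjunction and quantifiers is a matter of merging witnesses.\<close>

definition semidecidable :: "(nat \<Rightarrow> bool) \<Rightarrow> bool" where
  "semidecidable P \<longleftrightarrow>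
     (\<exists>Q. decidable (\<lambda>z. Q (pfst z) (psnd z)) \<and> (\<forall>x. P x \<longleftrightarrow> (\<exists>y. Q y x)))"

lemma semidecidableI:
  assumes "decidable (\<lambda>z. Q (pfst z) (psnd z))" "\<And>x. P x \<longleftrightarrow> (\<exists>y. Q y x)"
  shows "semidecidable P"
  using assms unfolding semidecidable_def by blast

lemma semidecidableE:
  assumes "semidecidable P"
  obtains Q where "\<And>f g. computable f \<Longrightarrow> computable g \<Longrightarrow> decidable (\<lambda>x. Q (f x) (g x))"
    "\<And>x. P x \<longleftrightarrow> (\<exists>y. Q y x)"
proof -
  obtain Q where Q: "decidable (\<lambda>z. Q (pfst z) (psnd z))" "\<And>x. P x \<longleftrightarrow> (\<exists>y. Q y x)"
    using assms unfolding semidecidable_def by blast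
  have "decidable (\<lambda>x. Q (f x) (g x))" if "computable f" "computable g" for f g
    using decidable_comp[OF Q(1) computable_prod_encode[OF that]] by simp
  with Q(2) show thesis by (rule that[rotated])
qed

lemma semidecidable_decidable:
  assumes "decidable P" shows "semidecidable P"
  by (rule semidecidableI[of "\<lambda>y. P"])
    (rule decidable_comp[OF assms computable_psnd[OF computable_id]], simp)

lemma semidecidable_comp:
  assumes "semidecidable P" "computable f" shows "semidecidable (\<lambda>x. P (f x))"
proof -
  obtain Q where Q: "\<And>f g. computable f \<Longrightarrow> computable g \<Longrightarrow> decidable (\<lambda>x. Q (f x) (g x))"
    "\<And>x. P x \<longleftrightarrow> (\<exists>y. Q y x)"
    using semidecidableE[OF assms(1)] by metis
  show ?thesis
    by (rule semidecidableI[of "\<lambda>y x. Q y (f x)"])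
      (use Q in \<open>auto intro!: Q(1) computable_intros computable_comp[OF assms(2)]\<close>)
qed

lemma semidecidable_ex:
  assumes "semidecidable (\<lambda>z. P (pfst z) (psnd z))"
  shows "semidecidable (\<lambda>x. \<exists>y. P y x)"
proof -
  obtain Q where Q: "\<And>f g. computable f \<Longrightarrow> computable g \<Longrightarrow> decidable (\<lambda>x. Q (f x) (g x))"
    "\<And>z. P (pfst z) (psnd z) \<longleftrightarrow> (\<exists>y. Q y z)"
    using semidecidableE[OF assms] by metis
  have P: "P y x \<longleftrightarrow> (\<exists>k. Q k (prod_encode (y, x)))" for x y
    using Q(2)[of "prod_encode (y, x)"] by simp
  show ?thesis
  proof (rule semidecidableI)
    show "decidable (\<lambda>z. Q (pfst (pfst z)) (prod_encode (psnd (pfst z), psnd z)))"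
      by (intro Q(1) computable_intros)
    show "(\<exists>y. P y x) \<longleftrightarrow> (\<exists>w. Q (pfst w) (prod_encode (psnd w, x)))" for x
      unfolding P by (metis fst_conv snd_conv prod_encode_inverse)
  qed
qed

lemma semidecidable_conj:
  assumes "semidecidable P" "semidecidable R" shows "semidecidable (\<lambda>x. P x \<and> R x)"
proof -
  obtain Q where Q: "\<And>f g. computable f \<Longrightarrow> computable g \<Longrightarrow> decidable (\<lambda>x. Q (f x) (g x))"
    "\<And>x. P x \<longleftrightarrow> (\<exists>y. Q y x)"
    using semidecidableE[OF assms(1)] by metis
  obtain Q' where Q': "\<And>f g. computable f \<Longrightarrow> computable g \<Longrightarrow> decidable (\<lambda>x. Q' (f x) (g x))"
    "\<And>x. R x \<longleftrightarrow> (\<exists>y. Q' y x)"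
    using semidecidableE[OF assms(2)] by metis
  have "semidecidable (\<lambda>x. \<exists>y y'. Q y x \<and> Q' y' x)"
    by (intro semidecidable_ex semidecidable_decidable decidable_conj Q Q' computable_intros)
  then show ?thesis unfolding Q(2) Q'(2) by simp
qed

lemma semidecidable_disj:
  assumes "semidecidable P" "semidecidable R" shows "semidecidable (\<lambda>x. P x \<or> R x)"
proof -
  obtain Q where Q: "\<And>f g. computable f \<Longrightarrow> computable g \<Longrightarrow> decidable (\<lambda>x. Q (f x) (g x))"
    "\<And>x. P x \<longleftrightarrow> (\<exists>y. Q y x)"
    using semidecidableE[OF assms(1)] by metis
  obtain Q' where Q': "\<And>f g. computable f \<Longrightarrow> computable g \<Longrightarrow> decidable (\<lambda>x. Q' (f x) (g x))"
    "\<And>x. R x \<longleftrightarrow> (\<exists>y. Q' y x)"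
    using semidecidableE[OF assms(2)] by metis
  have "semidecidable (\<lambda>x. \<exists>y. Q y x \<or> Q' y x)"
    by (intro semidecidable_ex semidecidable_decidable decidable_disj Q Q' computable_intros)
  then show ?thesis unfolding Q(2) Q'(2) by (simp add: ex_disj_distrib)
qed

text \<open>Finitely many witnesses have a common upper bound, so the unbounded search for them can be moved in
  front of the bounded quantifier.\<close>

lemma semidecidable_ball_less:
  assumes "computable b" "semidecidable (\<lambda>z. P (pfst z) (psnd z))"
  shows "semidecidable (\<lambda>x. \<forall>i<b x. P i x)"
proof -
  obtain Q where Q: "\<And>f g. computable f \<Longrightarrow> computable g \<Longrightarrow> decidable (\<lambda>x. Q (f x) (g x))"
    "\<And>z. P (pfst z) (psnd z) \<longleftrightarrow> (\<exists>y. Q y z)"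
    using semidecidableE[OF assms(2)] by metis
  have P: "P y x \<longleftrightarrow> (\<exists>k. Q k (prod_encode (y, x)))" for x y
    using Q(2)[of "prod_encode (y, x)"] by simp
  have "semidecidable (\<lambda>x. \<exists>m. \<forall>i<b x. \<exists>k<m. Q k (prod_encode (i, x)))"
    by (intro semidecidable_ex semidecidable_decidable decidable_ball_less decidable_bex_less Q
        computable_intros computable_comp[OF assms(1)])
  moreover have "(\<forall>i<b x. P i x) \<longleftrightarrow> (\<exists>m. \<forall>i<b x. \<exists>k<m. Q k (prod_encode (i, x)))" for x
  proof
    assume "\<forall>i<b x. P i x"
    then obtain k where k: "\<And>i. i < b x \<Longrightarrow> Q (k i) (prod_encode (i, x))" unfolding P by metis
    have "k i < Suc (Max (k ` {..<b x}))" if "i < b x" for i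
      using that by (simp add: less_Suc_eq_le)
    with k show "\<exists>m. \<forall>i<b x. \<exists>k<m. Q k (prod_encode (i, x))" by blast
  qed (use P in blast)
  ultimately show ?thesis by simp
qed

lemma semidecidable_ball_set_decode:
  assumes "computable f" "semidecidable (\<lambda>z. P (pfst z) (psnd z))"
  shows "semidecidable (\<lambda>x. \<forall>i\<in>set_decode (f x). P i x)"
proof -
  have "(\<forall>i\<in>set_decode (f x). P i x) \<longleftrightarrow> (\<forall>i<f x. i \<notin> set_decode (f x) \<or> P i x)" for x
    using set_decode_less by blast
  moreover have "semidecidable (\<lambda>x. \<forall>i<f x. i \<notin> set_decode (f x) \<or> P i x)"
    by (intro semidecidable_ball_less semidecidable_disj assms
        semidecidable_decidable[OF decidable_not] decidable_mem_set_decode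
        computable_intros computable_comp[OF assms(1)])
  ultimately show ?thesis by simp
qed

lemma semidecidable_ball_finite:
  assumes "finite F" "semidecidable (\<lambda>z. P (pfst z) (psnd z))"
  shows "semidecidable (\<lambda>x. \<forall>i\<in>F. P i x)"
  using semidecidable_ball_set_decode[OF computable_const[of "set_encode F"] assms(2)] assms(1)
  by simp

text \<open>To enumerate a nonempty semidecidable set, run through all pairs of a candidate witness and a
  number, and return a fixed element of the set whenever the witness fails.\<close>

theorem re_set_iff_semidecidable: "re_set M \<longleftrightarrow> semidecidable (\<lambda>x. x \<in> M)"
proof
  assume "re_set M"
  then consider "M = {}" | f where "recursive_fun 1 f" "M = range (\<lambda>n. f [n])"
    unfolding re_set_def by blast
  then show "semidecidable (\<lambda>x. x \<in> M)"
  proof cases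
    case 1
    then show ?thesis by (simp add: semidecidable_decidable decidable_const)
  next
    case 2
    have f: "computable (\<lambda>n. f [n])"
      unfolding computable_def
      by (rule recf_cong[OF recfI[OF 2(1)]]) (auto simp: length_Suc_conv)
    show ?thesis
      by (rule semidecidableI[of "\<lambda>n x. x = f [n]"])
        (use 2 in \<open>auto intro!: decidable_eq computable_intros computable_comp[OF f]\<close>)
  qed
next
  assume M: "semidecidable (\<lambda>x. x \<in> M)"
  show "re_set M"
  proof (cases "M = {}")
    case False
    then obtain m where m: "m \<in> M" by blast
    obtain Q where Q: "\<And>f g. computable f \<Longrightarrow> computable g \<Longrightarrow> decidable (\<lambda>x. Q (f x) (g x))"
      "\<And>x. x \<in> M \<longleftrightarrow> (\<exists>y. Q y x)"
      using semidecidableE[OF M] by metis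
    let ?f = "\<lambda>n. if Q (pfst n) (psnd n) then psnd n else m"
    have "computable ?f" by (intro computable_intros Q)
    then obtain f where f: "recursive_fun 1 f" "\<And>xs. length xs = 1 \<Longrightarrow> f xs = ?f (xs ! 0)"
      unfolding computable_def recf_def by blast
    have fn: "f [n] = ?f n" for n using f(2)[of "[n]"] by simp
    have "M = range (\<lambda>n. f [n])"
    proof (intro equalityI subsetI)
      fix x assume "x \<in> M"
      then obtain y where "Q y x" using Q(2) by blast
      then have "x = f [prod_encode (y, x)]" by (simp add: fn)
      then show "x \<in> range (\<lambda>n. f [n])" by blast
    qed (use m Q(2) in \<open>auto simp: fn split: if_splits\<close>)
    with f(1) show ?thesis unfolding re_set_def by blast
  qed (simp add: re_set_def)
qed

lemma semidecidable_mem_re: "re_set M \<Longrightarrow> computable f \<Longrightarrow> semidecidable (\<lambda>x. f x \<in> M)"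
  using semidecidable_comp[of "\<lambda>x. x \<in> M"] by (simp add: re_set_iff_semidecidable)

section \<open>Computing with words given by their codes\<close>

text \<open>One step of the loop that moves the letters of a word, changed by \<open>h\<close>, to the front of an
  accumulator; the state is the pair of the two word codes. This loop is the only recursion on words
  that is needed, since mapping and concatenation arise from running it twice.\<close>

definition revmap_step :: "(nat \<Rightarrow> nat) \<Rightarrow> nat \<Rightarrow> nat" where
  "revmap_step h z = (if pfst z = 0 then z else
     prod_encode (psnd (pfst z - 1), Suc (prod_encode (h (pfst (pfst z - 1)), psnd z))))"

lemma revmap_step_Nil: "revmap_step h (prod_encode (0, v)) = prod_encode (0, v)"
  by (simp add: revmap_step_def)

lemma revmap_step_Cons:
  "revmap_step h (prod_encode (list_encode (a # l), v))
    = prod_encode (list_encode l, Suc (prod_encode (h a, v)))"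
  by (simp add: revmap_step_def)

text \<open>The state with empty remaining word is a fixed point, so any bound on the length will do as the number
  of iterations; the code of the word is such a bound.\<close>

lemma revmap_step_iterate:
  assumes "length l \<le> n"
  shows "rec_nat (prod_encode (list_encode l, list_encode l')) (\<lambda>k. revmap_step h) n
    = prod_encode (0, list_encode (rev (map h l) @ l'))"
proof -
  have "rec_nat z (\<lambda>k. revmap_step h) n = (revmap_step h ^^ n) z" for z by (induction n) auto
  moreover have "(revmap_step h ^^ n) (prod_encode (list_encode l, list_encode l'))
      = prod_encode (0, list_encode (rev (map h l) @ l'))"
    using assms
  proof (induction n arbitrary: l l')
    case 0
    then show ?case by simp
  next
    case (Suc n)
    show ?case
    proof (cases l)
      case Nil
      then show ?thesis
        using Suc.IH[of "[]" l'] by (simp add: funpow_swap1 revmap_step_Nil)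
    next
      case (Cons a m)
      have "(revmap_step h ^^ Suc n) (prod_encode (list_encode l, list_encode l'))
          = (revmap_step h ^^ n) (prod_encode (list_encode m, list_encode (h a # l')))"
        unfolding Cons funpow_Suc_right o_apply revmap_step_Cons by simp
      also have "\<dots> = prod_encode (0, list_encode (rev (map h l) @ l'))"
        using Suc Cons by (subst Suc.IH) auto
      finally show ?thesis .
    qed
  qed
  ultimately show ?thesis by simp
qed

lemma length_le_list_encode: "length l \<le> list_encode l"
proof (induction l)
  case (Cons a l)
  then show ?case using le_prod_encode_2[of "list_encode l" a] by simp
qed simp

lemma computable_revmap:
  assumes "computable h" "computable f" "computable g"
  shows "computable (\<lambda>x. list_encode (rev (map h (list_decode (f x))) @ list_decode (g x)))"
proof -
  have "computable (\<lambda>x. psnd (rec_nat (prod_encode (f x, g x)) (\<lambda>k r. revmap_step h r) (f x)))"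
    unfolding revmap_step_def
    by (intro computable_intros computable_rec_nat decidable_eq computable_comp[OF assms(1)] assms)
  moreover have "rec_nat (prod_encode (f x, g x)) (\<lambda>k r. revmap_step h r) (f x)
      = prod_encode (0, list_encode (rev (map h (list_decode (f x))) @ list_decode (g x)))" for x
    using revmap_step_iterate[of "list_decode (f x)" "f x" "list_decode (g x)"]
      length_le_list_encode[of "list_decode (f x)"] by simp
  ultimately show ?thesis by simp
qed

lemma computable_map:
  assumes "computable h" "computable f"
  shows "computable (\<lambda>x. list_encode (map h (list_decode (f x))))"
  using computable_revmap[OF computable_id
      computable_revmap[OF assms computable_const[of 0]] computable_const[of 0]]
  by (simp add: rev_map)

lemma computable_append:
  assumes "computable f" "computable g"
  shows "computable (\<lambda>x. list_encode (list_decode (f x) @ list_decode (g x)))"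
  using computable_revmap[OF computable_id
      computable_revmap[OF computable_id assms(1) computable_const[of 0]] assms(2)]
  by (simp add: rev_map)

lemma decidable_lists:
  assumes "finite F" "computable f"
  shows "decidable (\<lambda>x. list_decode (f x) \<in> lists F)"
proof -
  \<comment> \<open>the words over \<open>F\<close> are the fixed points of moving every letter outside \<open>F\<close>\<close>
  let ?h = "\<lambda>i. if i \<in> F then i else Suc i"
  have "decidable (\<lambda>x. list_encode (map ?h (list_decode (f x))) = f x)"
    by (intro decidable_eq computable_map computable_intros decidable_finite_mem assms)
  moreover have "list_encode (map ?h (list_decode n)) = n \<longleftrightarrow> list_decode n \<in> lists F" for n
  proof -
    have "map ?h l = l \<longleftrightarrow> l \<in> lists F" for l by (induction l) auto
    then show ?thesis by (metis list_encode_inverse list_decode_inverse)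
  qed
  ultimately show ?thesis by simp
qed

section \<open>Satisfiability of recursively enumerable families of clauses\<close>

text \<open>A pair \<open>(p, q)\<close> codes the clause ``if all variables in \<open>p\<close> hold, then some variable in \<open>q\<close> holds''.
  An assignment is the set \<open>Y\<close> of variables that hold.\<close>

definition models :: "nat set \<Rightarrow> (nat \<times> nat) set \<Rightarrow> bool" where
  "models Y C \<longleftrightarrow> (\<forall>(p, q)\<in>C. set_decode p \<subseteq> Y \<longrightarrow> set_decode q \<inter> Y \<noteq> {})"

text \<open>The assignments form the Cantor space, and the models of one clause are a closed set because a clause
  looks at finitely many variables.\<close>

lemma models_compactness:
  assumes "\<And>F. finite F \<Longrightarrow> F \<subseteq> C \<Longrightarrow> \<exists>Y. models Y F"
  shows "\<exists>Y. models Y C"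
proof -
  define T where "T = product_topology (\<lambda>_::nat. discrete_topology (UNIV :: bool set)) UNIV"
  define K where "K \<kappa> = {\<chi>. models {i. \<chi> i} {\<kappa>}}" for \<kappa>
  have "compact_space T"
    unfolding T_def by (simp add: compact_space_product_topology compact_space_discrete_topology)
  moreover have "closedin T (K \<kappa>)" for \<kappa>
  proof -
    obtain p q where \<kappa>: "\<kappa> = (p, q)" by force
    let ?S = "\<lambda>i. {b. (i \<in> set_decode p \<longrightarrow> b) \<and> (i \<in> set_decode q \<longrightarrow> \<not> b)}"
    have "{i. ?S i \<noteq> UNIV} \<subseteq> set_decode p \<union> set_decode q" by auto
    then have "finite {i. ?S i \<noteq> UNIV}" by (rule finite_subset) simp
    then have "openin T (PiE UNIV ?S)"
      unfolding T_def openin_PiE_gen by simp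
    moreover have "topspace T - K \<kappa> = PiE UNIV ?S"
      by (auto simp: T_def K_def models_def \<kappa> PiE_iff)
    ultimately show ?thesis
      by (auto simp: closedin_def T_def)
  qed
  moreover have "\<Inter>\<F> \<noteq> {}" if fin: "finite \<F>" "\<F> \<subseteq> K ` C" for \<F>
  proof -
    obtain F where F: "finite F" "F \<subseteq> C" "\<F> = K ` F"
      using finite_subset_image[OF fin] by blast
    obtain Y where "models Y F" using assms F by blast
    then have "(\<lambda>i. i \<in> Y) \<in> \<Inter>\<F>" by (auto simp: F(3) K_def models_def)
    then show ?thesis by blast
  qed
  ultimately have "\<Inter>(K ` C) \<noteq> {}"
    unfolding compact_space_fip by blast
  then obtain \<chi> where "\<And>\<kappa>. \<kappa> \<in> C \<Longrightarrow> \<chi> \<in> K \<kappa>" by blast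
  then have "models {i. \<chi> i} C" by (fastforce simp: K_def models_def)
  then show ?thesis ..
qed

lemma set_encode_less_pow2: "Y \<subseteq> {..<n} \<Longrightarrow> set_encode Y < 2 ^ n"
proof -
  assume "Y \<subseteq> {..<n}"
  then have "set_encode Y \<le> (\<Sum>i<n. 2 ^ i)"
    unfolding set_encode_def by (intro sum_mono2) auto
  also have "\<dots> < 2 ^ n" by (induction n) auto
  finally show ?thesis .
qed

text \<open>By compactness finitely many clauses are already contradictory. With \<open>n\<close> above all variables on
  their right-hand sides, every \<open>y\<close> violates one of them. Conversely a model \<open>Y\<close>, cut off at \<open>n\<close>, is
  among the \<open>y < 2^n\<close>; as the variables in \<open>q\<close> are below \<open>n\<close>, the clause violated by the
  truncation is violated by \<open>Y\<close> itself.\<close>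

lemma unsatisfiable_iff_truncated:
  "\<not> (\<exists>Y. models Y C) \<longleftrightarrow>
    (\<exists>n. \<forall>y<2^n. \<exists>p q. (p, q) \<in> C \<and> (\<forall>i\<in>set_decode p. i \<in> set_decode y)
      \<and> (\<forall>i\<in>set_decode q. i < n \<and> i \<notin> set_decode y))" (is "?L \<longleftrightarrow> ?R")
proof
  assume ?L
  then obtain F where F: "finite F" "F \<subseteq> C" "\<not> (\<exists>Y. models Y F)"
    using models_compactness[of C] by blast
  obtain n where n: "\<And>p q i. (p, q) \<in> F \<Longrightarrow> i \<in> set_decode q \<Longrightarrow> i < n"
  proof -
    have "finite (\<Union>(p, q)\<in>F. set_decode q)" using F(1) by auto
    then obtain n where "\<forall>i\<in>(\<Union>(p, q)\<in>F. set_decode q). i < n"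
      by (auto simp: finite_nat_set_iff_bounded)
    then show thesis by (intro that) blast
  qed
  have "\<exists>p q. (p, q) \<in> C \<and> (\<forall>i\<in>set_decode p. i \<in> set_decode y)
      \<and> (\<forall>i\<in>set_decode q. i < n \<and> i \<notin> set_decode y)" for y
  proof -
    have "\<not> models (set_decode y) F" using F(3) by blast
    then obtain p q where "(p, q) \<in> F" "set_decode p \<subseteq> set_decode y"
      "set_decode q \<inter> set_decode y = {}"
      unfolding models_def by blast
    then show ?thesis using F(2) n by (intro exI[of _ p] exI[of _ q]) auto
  qed
  then show ?R by blast
next
  assume ?R
  then obtain n where n: "\<And>y. y < 2^n \<Longrightarrow> \<exists>p q. (p, q) \<in> C \<and> (\<forall>i\<in>set_decode p. i \<in> set_decode y)
      \<and> (\<forall>i\<in>set_decode q. i < n \<and> i \<notin> set_decode y)" by blast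
  show ?L
  proof
    assume "\<exists>Y. models Y C"
    then obtain Y where Y: "models Y C" ..
    have "\<exists>p q. (p, q) \<in> C \<and> (\<forall>i\<in>set_decode p. i \<in> Y \<inter> {..<n})
        \<and> (\<forall>i\<in>set_decode q. i < n \<and> i \<notin> Y \<inter> {..<n})"
      using n[of "set_encode (Y \<inter> {..<n})"] set_encode_less_pow2[of "Y \<inter> {..<n}" n] by simp
    then obtain p q where "(p, q) \<in> C" "set_decode p \<subseteq> Y" "set_decode q \<inter> Y = {}"
      by blast
    then show False using Y unfolding models_def by blast
  qed
qed

text \<open>In the truncated form all universal quantifiers are bounded.\<close>

theorem semidecidable_unsatisfiable:
  assumes "semidecidable (\<lambda>z. cl (pfst z) (pfst (psnd z)) (psnd (psnd z)))"
  shows "semidecidable (\<lambda>x. \<not> (\<exists>Y. models Y {(p, q). cl x p q}))"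
proof -
  have cl: "semidecidable (\<lambda>x. cl (f x) (g x) (h x))"
    if "computable f" "computable g" "computable h" for f g h
    using semidecidable_comp[OF assms, of "\<lambda>x. prod_encode (f x, prod_encode (g x, h x))"] that
    by (simp add: computable_prod_encode)
  show ?thesis
    unfolding unsatisfiable_iff_truncated mem_Collect_eq prod.case
    by (intro semidecidable_ex semidecidable_ball_less semidecidable_conj cl
        semidecidable_decidable[OF decidable_ball_set_decode] decidable_conj decidable_not
        decidable_less decidable_mem_set_decode computable_intros)
qed

text \<open>Asserting a variable is adding a clause with that variable on the right. Keeping all clauses
  that contain some variable of \<open>I\<close> on the right, instead of the unit clauses only, changes nothing and
  gives a simpler formula.\<close>

lemma models_with_units:
  "models Y {(p, q). P p q \<or> (\<exists>i\<in>I. i \<in> set_decode q)} \<longleftrightarrow> models Y {(p, q). P p q} \<and> I \<subseteq> Y"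
proof
  assume L: "models Y {(p, q). P p q \<or> (\<exists>i\<in>I. i \<in> set_decode q)}"
  have "i \<in> Y" if "i \<in> I" for i
  proof -
    have dec: "set_decode (set_encode {i}) = {i}" by (rule set_encode_inverse) simp
    have "\<forall>p q. (\<exists>i\<in>I. i \<in> set_decode q) \<longrightarrow> set_decode p \<subseteq> Y \<longrightarrow> set_decode q \<inter> Y \<noteq> {}"
      using L unfolding models_def by blast
    from this[THEN spec[of _ 0], THEN spec[of _ "set_encode {i}"]] that show ?thesis
      unfolding dec by auto
  qed
  moreover have "models Y {(p, q). P p q}" using L unfolding models_def by blast
  ultimately show "models Y {(p, q). P p q} \<and> I \<subseteq> Y" by blast
qed (auto simp: models_def)

lemma models_mono: "models Y C \<Longrightarrow> D \<subseteq> C \<Longrightarrow> models Y D"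
  unfolding models_def by (rule ballI) (drule (1) subsetD, drule (1) bspec)

text \<open>Finitely many clauses mention only finitely many of the asserted variables.\<close>

lemma models_units_compactness:
  assumes "\<And>J. finite J \<Longrightarrow> J \<subseteq> I \<Longrightarrow> \<exists>Y. models Y C \<and> J \<subseteq> Y"
  shows "\<exists>Y. models Y C \<and> I \<subseteq> Y"
proof -
  let ?C = "\<lambda>I. {(p, q). (p, q) \<in> C \<or> (\<exists>i\<in>I. i \<in> set_decode q)}"
  have C: "models Y (?C I) \<longleftrightarrow> models Y C \<and> I \<subseteq> Y" for Y I
    using models_with_units[of Y "\<lambda>p q. (p, q) \<in> C" I] by simp
  have "\<exists>Y. models Y F" if F: "finite F" "F \<subseteq> ?C I" for F
  proof -
    define J where "J = I \<inter> (\<Union>(p, q)\<in>F. set_decode q)"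
    have "finite J" unfolding J_def using F(1) by (intro finite_Int disjI2 finite_UN_I) auto
    then obtain Y where "models Y (?C J)" using assms[of J] C by (auto simp: J_def)
    moreover have "F \<subseteq> ?C J" using F(2) by (auto simp: J_def)
    ultimately show ?thesis using models_mono by blast
  qed
  then have "\<exists>Y. models Y (?C I)" by (rule models_compactness)
  then show ?thesis using C by blast
qed

section \<open>Values of words\<close>

lemma (in monoid) word_value_closed: "w \<in> lists (carrier G) \<Longrightarrow> word_value G w \<in> carrier G"
  by (induction w) (auto simp: word_value_def)

lemma (in monoid) word_value_append:
  "u \<in> lists (carrier G) \<Longrightarrow> v \<in> lists (carrier G) \<Longrightarrow>
    word_value G (u @ v) = word_value G u \<otimes> word_value G v"
proof (induction u)
  case Nil
  then show ?case using word_value_closed[of v] by (simp add: word_value_def)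
next
  case (Cons a u)
  then show ?case
    using word_value_closed[of v] word_value_closed[of u] by (simp add: word_value_def m_assoc)
qed

lemma (in monoid) word_value_singleton: "a \<in> carrier G \<Longrightarrow> word_value G [a] = a"
  by (simp add: word_value_def)

lemma word_value_surj:
  assumes "group K" "fin_gen_set K S" "g \<in> carrier K"
  obtains w where "w \<in> lists S" "word_value K w = g"
proof -
  interpret group K by fact
  have S: "S \<subseteq> carrier K" "\<And>s. s \<in> S \<Longrightarrow> inv\<^bsub>K\<^esub> s \<in> S" and g: "g \<in> generate K S"
    using assms(2,3) by (auto simp: fin_gen_set_def)
  from g have "\<exists>w\<in>lists S. word_value K w = g"
  proof induction
    case one
    show ?case by (intro bexI[of _ "[]"]) (auto simp: word_value_def)
  next
    case (incl h)
    then show ?case using S by (intro bexI[of _ "[h]"]) (auto simp: word_value_def)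
  next
    case (inv h)
    then show ?case using S by (intro bexI[of _ "[inv\<^bsub>K\<^esub> h]"]) (auto simp: word_value_def)
  next
    case (eng h1 h2)
    then obtain w1 w2 where "w1 \<in> lists S" "word_value K w1 = h1" "w2 \<in> lists S" "word_value K w2 = h2"
      by blast
    moreover have "w1 \<in> lists (carrier K)" "w2 \<in> lists (carrier K)"
      using S(1) calculation lists_mono by blast+
    ultimately show ?case
      using word_value_append[of w1 w2] by (intro bexI[of _ "w1 @ w2"]) auto
  qed
  then show thesis using that by blast
qed

section \<open>The word problem of a recursively presented group\<close>

lemma pres_eq_in_lists:
  assumes "R \<subseteq> lists (S \<times> UNIV)" "pres_eq S R u v"
  shows "u \<in> lists (S \<times> UNIV)" "v \<in> lists (S \<times> UNIV)"
proof -
  have "u \<in> lists (S \<times> UNIV) \<and> v \<in> lists (S \<times> UNIV)"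
    using assms(2) by (induction) (use assms(1) in auto)
  then show "u \<in> lists (S \<times> UNIV)" "v \<in> lists (S \<times> UNIV)" by auto
qed

lemma pres_eq_context:
  assumes "pres_eq S R u v" "x \<in> lists (S \<times> UNIV)" "y \<in> lists (S \<times> UNIV)"
  shows "pres_eq S R (x @ u @ y) (x @ v @ y)"
  using assms(1)
proof induction
  case (refl u)
  then show ?case using assms(2,3) by (intro pres_eq.refl) auto
next
  case (sym u v)
  from sym.IH show ?case by (rule pres_eq.sym)
next
  case (trans u v w)
  from trans.IH show ?case by (rule pres_eq.trans)
next
  case (cancel u v s b)
  then show ?case using pres_eq.cancel[of "x @ u" S "v @ y" s R b] assms(2,3) by simp
next
  case (relator u v r)
  then show ?case using pres_eq.relator[of "x @ u" S "v @ y" r R] assms(2,3) by simp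
qed

lemma pres_eq_append:
  assumes "R \<subseteq> lists (S \<times> UNIV)" "pres_eq S R u u'" "pres_eq S R v v'"
  shows "pres_eq S R (u @ v) (u' @ v')"
proof -
  have "pres_eq S R ([] @ u @ v) ([] @ u' @ v)"
    by (intro pres_eq_context assms pres_eq_in_lists[OF assms(1,3)]) auto
  moreover have "pres_eq S R (u' @ v @ []) (u' @ v' @ [])"
    by (intro pres_eq_context assms pres_eq_in_lists[OF assms(1,2)]) auto
  ultimately show ?thesis by (auto intro: pres_eq.trans)
qed

text \<open>An isomorphism onto the presented group, read backwards, evaluates words in the presentation's
  letters: two such words have the same value iff the presentation identifies them.\<close>

lemma presentation_map:
  assumes "group G" "R \<subseteq> lists (S \<times> UNIV)" "G \<cong> presented_group S R"
  obtains \<psi> where "\<And>u. u \<in> lists (S \<times> UNIV) \<Longrightarrow> \<psi> u \<in> carrier G"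
    and "\<And>u v. u \<in> lists (S \<times> UNIV) \<Longrightarrow> v \<in> lists (S \<times> UNIV) \<Longrightarrow> \<psi> (u @ v) = \<psi> u \<otimes>\<^bsub>G\<^esub> \<psi> v"
    and "\<And>u v. u \<in> lists (S \<times> UNIV) \<Longrightarrow> v \<in> lists (S \<times> UNIV) \<Longrightarrow> \<psi> u = \<psi> v \<longleftrightarrow> pres_eq S R u v"
    and "\<And>g. g \<in> carrier G \<Longrightarrow> \<exists>u\<in>lists (S \<times> UNIV). \<psi> u = g"
proof -
  interpret group G by fact
  let ?W = "lists (S \<times> UNIV)" and ?P = "presented_group S R"
  define cls where "cls u = {w. pres_eq S R u w}" for u
  have cls_eq: "cls u = cls v \<longleftrightarrow> pres_eq S R u v" if "u \<in> ?W" "v \<in> ?W" for u v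
    unfolding cls_def using that by (blast intro: pres_eq.intros)
  have carrier: "carrier ?P = cls ` ?W"
    by (auto simp: presented_group_def cls_def quotient_def)
  have mult: "cls u \<otimes>\<^bsub>?P\<^esub> cls v = cls (u @ v)" if "u \<in> ?W" "v \<in> ?W" for u v
  proof -
    have "cls u \<otimes>\<^bsub>?P\<^esub> cls v = (\<Union>u'\<in>cls u. \<Union>v'\<in>cls v. cls (u' @ v'))"
      by (simp add: presented_group_def cls_def)
    moreover have "cls (u' @ v') = cls (u @ v)" if "u' \<in> cls u" "v' \<in> cls v" for u' v'
    proof -
      have *: "pres_eq S R u u'" "pres_eq S R v v'" using that by (auto simp: cls_def)
      show ?thesis
        using pres_eq_append[OF assms(2) *] pres_eq_in_lists[OF assms(2) *(1)]
          pres_eq_in_lists[OF assms(2) *(2)] by (subst cls_eq) (auto intro: pres_eq.sym)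
    qed
    moreover have "u \<in> cls u" "v \<in> cls v" using that by (auto simp: cls_def pres_eq.refl)
    ultimately show ?thesis by blast
  qed
  obtain \<phi> where \<phi>: "\<phi> \<in> iso G ?P" using assms(3) by (auto simp: is_iso_def)
  then have hom: "\<And>x y. x \<in> carrier G \<Longrightarrow> y \<in> carrier G \<Longrightarrow> \<phi> (x \<otimes>\<^bsub>G\<^esub> y) = \<phi> x \<otimes>\<^bsub>?P\<^esub> \<phi> y"
    and bij: "bij_betw \<phi> (carrier G) (carrier ?P)"
    by (auto simp: iso_def hom_def)
  define \<psi> where "\<psi> u = inv_into (carrier G) \<phi> (cls u)" for u
  have \<psi>: "\<psi> u \<in> carrier G" "\<phi> (\<psi> u) = cls u" if "u \<in> ?W" for u
  proof -
    have "cls u \<in> \<phi> ` carrier G"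
      using bij that unfolding carrier bij_betw_def by blast
    then show "\<psi> u \<in> carrier G" "\<phi> (\<psi> u) = cls u"
      unfolding \<psi>_def by (rule inv_into_into, rule f_inv_into_f)
  qed
  have inj: "x = y" if "\<phi> x = \<phi> y" "x \<in> carrier G" "y \<in> carrier G" for x y
    using bij that by (auto simp: bij_betw_def inj_on_def)
  show thesis
  proof
    show "\<psi> u \<in> carrier G" if "u \<in> ?W" for u using \<psi> that by simp
    show "\<psi> (u @ v) = \<psi> u \<otimes>\<^bsub>G\<^esub> \<psi> v" if "u \<in> ?W" "v \<in> ?W" for u v
      using that by (intro inj) (auto simp: \<psi> hom mult)
    show "\<psi> u = \<psi> v \<longleftrightarrow> pres_eq S R u v" if "u \<in> ?W" "v \<in> ?W" for u v
      using \<psi>(2)[OF that(1)] \<psi>(2)[OF that(2)] cls_eq[OF that] by (metis \<psi>_def)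
    show "\<exists>u\<in>?W. \<psi> u = g" if g: "g \<in> carrier G" for g
    proof -
      have "\<phi> g \<in> cls ` ?W" using bij g unfolding carrier bij_betw_def by blast
      then obtain u where "u \<in> ?W" "\<phi> g = cls u" by blast
      then show ?thesis using \<psi> g inj by metis
    qed
  qed
qed

text \<open>Invariance under replacing a factor according to \<open>E\<close> is invariance under the congruence generated
  by \<open>E\<close>. Speaking about invariant predicates avoids the congruence and the derivations in it.\<close>

definition rewrite_invariant :: "(nat list \<Rightarrow> nat list \<Rightarrow> bool) \<Rightarrow> (nat list \<Rightarrow> bool) \<Rightarrow> bool" where
  "rewrite_invariant E Q \<longleftrightarrow> (\<forall>x l r y. E l r \<longrightarrow> Q (x @ l @ y) = Q (x @ r @ y))"

lemma prod_encode_pfst_psnd: "z = prod_encode (pfst z, psnd z)"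
  by simp

text \<open>Equality in \<open>G\<close> is generated by a recursively enumerable set of rewriting steps on words. The
  letters are the given numbers of the elements of \<open>U\<close> together with the letters of a recursive
  presentation. The steps replace a letter of \<open>U\<close> by a word of the presentation with the same value,
  cancel formal inverses, and delete relators. To have all numbers as letters, the remaining ones
  denote the identity and may be deleted. By the first and last kind of step every word can be brought
  into the letters of the presentation, where equality in \<open>G\<close> is the presented congruence.\<close>

lemma recursively_enumerable_rewriting:
  fixes G :: "('g, 'm) monoid_scheme" and e :: "'g \<Rightarrow> nat"
  assumes "group G" "recursively_presented G" "finite U" "U \<subseteq> carrier G" "inj_on e U"
  obtains val :: "nat \<Rightarrow> 'g" and E :: "nat list \<Rightarrow> nat list \<Rightarrow> bool"
  where "\<And>u. u \<in> U \<Longrightarrow> val (e u) = u" and "\<And>i. val i \<in> carrier G"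
    and "semidecidable (\<lambda>z. E (list_decode (pfst z)) (list_decode (psnd z)))"
    and "\<And>l r. E l r \<Longrightarrow> word_value G (map val l) = word_value G (map val r)"
    and "\<forall>Q l l'. rewrite_invariant E Q \<longrightarrow>
          word_value G (map val l) = word_value G (map val l') \<longrightarrow> Q l = Q l'"
proof -
  interpret group G by fact
  obtain S :: "nat set" and R where S: "finite S" and R: "re_words (S \<times> UNIV) R"
    and iso: "G \<cong> presented_group S R"
    using assms(2) unfolding recursively_presented_def by blast
  obtain e0 where RW: "R \<subseteq> lists (S \<times> UNIV)" and e0: "inj_on e0 (S \<times> (UNIV :: bool set))"
    and re: "re_set ((\<lambda>w. list_encode (map e0 w)) ` R)"
    using R unfolding re_words_def by blast
  let ?W = "lists (S \<times> (UNIV :: bool set))"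
  obtain \<psi> where \<psi>: "\<And>u. u \<in> ?W \<Longrightarrow> \<psi> u \<in> carrier G"
    and \<psi>_append: "\<And>u v. u \<in> ?W \<Longrightarrow> v \<in> ?W \<Longrightarrow> \<psi> (u @ v) = \<psi> u \<otimes>\<^bsub>G\<^esub> \<psi> v"
    and \<psi>_eq: "\<And>u v. u \<in> ?W \<Longrightarrow> v \<in> ?W \<Longrightarrow> \<psi> u = \<psi> v \<longleftrightarrow> pres_eq S R u v"
    and \<psi>_surj: "\<And>g. g \<in> carrier G \<Longrightarrow> \<exists>u\<in>?W. \<psi> u = g"
    by (rule presentation_map[OF assms(1) RW iso]) (rule that)
  have \<psi>_Nil: "\<psi> [] = \<one>\<^bsub>G\<^esub>"
    using \<psi>_append[of "[]" "[]"] \<psi>[of "[]"] by simp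
  obtain \<rho> where \<rho>: "\<And>g. g \<in> carrier G \<Longrightarrow> \<rho> g \<in> ?W" "\<And>g. g \<in> carrier G \<Longrightarrow> \<psi> (\<rho> g) = g"
    using \<psi>_surj by metis
  \<comment> \<open>the numbers of the letters of the presentation are moved above those of \<open>U\<close>\<close>
  obtain K where K: "\<And>u. u \<in> U \<Longrightarrow> e u < K"
    using assms(3) finite_nat_set_iff_bounded[of "e ` U"] by auto
  define c where "c = (\<lambda>s. K + e0 s)"
  have c_inj: "inj_on c (S \<times> UNIV)" using e0 by (auto simp: c_def inj_on_def)
  have disj: "e u \<noteq> c s" if "u \<in> U" for u s using K[OF that] by (simp add: c_def)
  define val where "val i = (if i \<in> e ` U then inv_into U e i
    else if i \<in> c ` (S \<times> UNIV) then \<psi> [inv_into (S \<times> UNIV) c i] else \<one>\<^bsub>G\<^esub>)" for i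
  have val_e: "val (e u) = u" if "u \<in> U" for u
    using that assms(5) by (simp add: val_def)
  have val_c: "val (c s) = \<psi> [s]" if "s \<in> S \<times> UNIV" for s
  proof -
    have "c s \<notin> e ` U" using disj by (metis imageE)
    then show ?thesis
      using that inv_into_f_f[OF c_inj that] by (simp only: val_def if_False image_eqI if_True)
  qed
  have val_junk: "val i = \<one>\<^bsub>G\<^esub>" if "i \<notin> e ` U \<union> c ` (S \<times> UNIV)" for i
    using that by (auto simp: val_def)
  have val_closed: "val i \<in> carrier G" for i
  proof (cases "i \<in> e ` U \<union> c ` (S \<times> UNIV)")
    case True
    then show ?thesis using val_e val_c assms(4) by (auto intro!: \<psi>)
  qed (simp add: val_junk)
  let ?v = "\<lambda>l. word_value G (map val l)"
  have v_closed: "?v l \<in> carrier G" for l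
    by (intro word_value_closed) (auto simp: val_closed)
  have v_append: "?v (l @ r) = ?v l \<otimes>\<^bsub>G\<^esub> ?v r" for l r
    unfolding map_append by (intro word_value_append) (auto simp: val_closed)
  have v_single: "?v [i] = val i" for i by (simp add: word_value_singleton val_closed)
  have v_Nil: "?v [] = \<one>\<^bsub>G\<^esub>" by (simp add: word_value_def)
  have v_c: "?v (map c u) = \<psi> u" if "u \<in> ?W" for u
    using that
  proof (induction u)
    case Nil
    then show ?case using \<psi>_Nil v_Nil by simp
  next
    case (Cons s u)
    then show ?case
      using \<psi>_append[of "[s]" u] v_append[of "[c s]" "map c u"] v_single[of "c s"] val_c[of s]
      by simp
  qed
  let ?L = "e ` U \<union> c ` (S \<times> UNIV)"
  define Fin where "Fin = (\<lambda>u. ([e u], map c (\<rho> u))) ` U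
    \<union> (\<lambda>(s, b). ([c (s, b), c (s, \<not> b)], [])) ` (S \<times> UNIV)"
  define E where "E l r \<longleftrightarrow> (l, r) \<in> Fin
    \<or> (r = [] \<and> (l \<in> map c ` R \<or> (\<exists>i. i \<notin> ?L \<and> l = [i])))" for l r
  show thesis
  proof (rule that[of val E])
    show "semidecidable (\<lambda>z. E (list_decode (pfst z)) (list_decode (psnd z)))"
    proof -
      let ?R = "(\<lambda>w. list_encode (map e0 w)) ` R"
      have "E (list_decode (pfst z)) (list_decode (psnd z)) \<longleftrightarrow>
          z \<in> (\<lambda>(l, r). prod_encode (list_encode l, list_encode r)) ` Fin \<or>
          (psnd z = 0 \<and> ((\<exists>k. k \<in> ?R \<and> pfst z = list_encode (map (\<lambda>i. K + i) (list_decode k)))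
            \<or> (\<exists>i. i \<notin> ?L \<and> pfst z = Suc (prod_encode (i, 0)))))" for z
      proof -
        obtain l r where z: "z = prod_encode (list_encode l, list_encode r)"
          by (metis prod_encode_pfst_psnd list_decode_inverse)
        have "z \<in> (\<lambda>(l, r). prod_encode (list_encode l, list_encode r)) ` Fin \<longleftrightarrow> (l, r) \<in> Fin"
        proof -
          have "inj (\<lambda>(l, r). prod_encode (list_encode l, list_encode r))"
            by (auto intro!: injI simp: list_encode_eq)
          from inj_image_mem_iff[OF this, of "(l, r)" Fin] show ?thesis by (simp add: z)
        qed
        moreover have "psnd z = 0 \<longleftrightarrow> r = []"
          by (metis z prod_encode_inverse snd_conv list_encode.simps(1) list_encode_inverse)
        moreover have "(\<exists>k. k \<in> ?R \<and> pfst z = list_encode (map (\<lambda>i. K + i) (list_decode k)))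
            \<longleftrightarrow> l \<in> map c ` R"
          by (auto simp: z c_def comp_def list_encode_eq image_iff)
        moreover have "pfst z = Suc (prod_encode (i, 0)) \<longleftrightarrow> l = [i]" for i
        proof -
          have "Suc (prod_encode (i, 0)) = list_encode [i]" by simp
          then show ?thesis unfolding z by (simp del: list_encode.simps add: list_encode_eq)
        qed
        moreover have "E (list_decode (pfst z)) (list_decode (psnd z)) = E l r"
          by (simp add: z)
        ultimately show ?thesis unfolding E_def by simp
      qed
      moreover have "semidecidable (\<lambda>z.
          z \<in> (\<lambda>(l, r). prod_encode (list_encode l, list_encode r)) ` Fin \<or>
          (psnd z = 0 \<and> ((\<exists>k. k \<in> ?R \<and> pfst z = list_encode (map (\<lambda>i. K + i) (list_decode k)))
            \<or> (\<exists>i. i \<notin> ?L \<and> pfst z = Suc (prod_encode (i, 0))))))"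
        by (intro semidecidable_disj semidecidable_conj semidecidable_ex
            semidecidable_mem_re[OF re] semidecidable_decidable[OF decidable_not]
            semidecidable_decidable[OF decidable_eq] semidecidable_decidable[OF decidable_finite_mem]
            decidable_finite_mem computable_map computable_intros)
          (use assms(3) S in \<open>auto simp: Fin_def\<close>)
      ultimately show ?thesis by simp
    qed
    show "?v l = ?v r" if E: "E l r" for l r
    proof -
      consider u where "u \<in> U" "l = [e u]" "r = map c (\<rho> u)"
        | s b where "s \<in> S" "l = map c [(s, b), (s, \<not> b)]" "r = map c []"
        | w where "w \<in> R" "l = map c w" "r = map c []"
        | i where "i \<notin> ?L" "l = [i]" "r = []"
        using E unfolding E_def Fin_def by auto
      then show ?thesis
      proof cases
        case 1
        then show ?thesis using assms(4) \<rho>[of u] by (auto simp only: v_c v_single val_e)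
      next
        case 2
        then have "pres_eq S R ([] @ [(s, b), (s, \<not> b)] @ []) ([] @ [])"
          by (intro pres_eq.cancel) auto
        with 2 have "\<psi> [(s, b), (s, \<not> b)] = \<psi> []"
          by (subst \<psi>_eq) auto
        then show ?thesis using 2 v_c[of "[(s, b), (s, \<not> b)]"] v_c[of "[]"] by simp
      next
        case 3
        then have "pres_eq S R ([] @ w @ []) ([] @ [])"
          by (intro pres_eq.relator) auto
        with 3 RW have "\<psi> w = \<psi> []"
          by (subst \<psi>_eq) auto
        then show ?thesis using 3 RW v_c[of w] v_c[of "[]"] by auto
      next
        case 4
        then show ?thesis using val_junk[of i] v_single[of i] v_Nil by simp
      qed
    qed
    show "\<forall>Q l l'. rewrite_invariant E Q \<longrightarrow> ?v l = ?v l' \<longrightarrow> Q l = Q l'"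
    proof (intro allI impI)
      fix Q :: "nat list \<Rightarrow> bool" and l l'
      assume Q: "rewrite_invariant E Q" and eq: "?v l = ?v l'"
      have inv: "Q (x @ l @ y) = Q (x @ r @ y)" if "E l r" for x l r y
        using Q that unfolding rewrite_invariant_def by blast
      \<comment> \<open>the left context \<open>x\<close> absorbs the letters that are already replaced\<close>
      have normal_form: "\<exists>u\<in>?W. \<psi> u = ?v l \<and> (\<forall>x. Q (x @ l) = Q (x @ map c u))" for l
      proof (induction l)
        case Nil
        show ?case using \<psi>_Nil v_Nil by (intro bexI[of _ "[]"]) auto
      next
        case (Cons i l)
        then obtain u where u: "u \<in> ?W" "\<psi> u = ?v l" "\<And>x. Q (x @ l) = Q (x @ map c u)" by blast
        have "\<exists>w\<in>?W. \<psi> w = val i \<and> (\<forall>x. Q (x @ [i] @ l) = Q (x @ map c w @ l))"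
        proof -
          consider a where "a \<in> U" "i = e a" | s where "s \<in> S \<times> UNIV" "i = c s" | "i \<notin> ?L" by blast
          then show ?thesis
          proof cases
            case 1
            then have "E [i] (map c (\<rho> a))" by (auto simp: E_def Fin_def)
            then show ?thesis using inv[of "[i]" "map c (\<rho> a)" _ l] \<rho>[of a] 1 assms(4) val_e
              by (intro bexI[of _ "\<rho> a"]) auto
          next
            case 2
            then show ?thesis using val_c by (intro bexI[of _ "[s]"]) auto
          next
            case 3
            then have "E [i] (map c [])" by (auto simp: E_def)
            then show ?thesis using inv[of "[i]" "map c []" _ l] val_junk[OF 3] \<psi>_Nil
              by (intro bexI[of _ "[]"]) auto
          qed
        qed
        then obtain w where w: "w \<in> ?W" "\<psi> w = val i" "\<And>x. Q (x @ [i] @ l) = Q (x @ map c w @ l)" by blast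
        have "Q (x @ i # l) = Q (x @ map c (w @ u))" for x
          using w(3)[of x] u(3)[of "x @ map c w"] by simp
        moreover have "\<psi> (w @ u) = ?v (i # l)"
          using w(1,2) u(1,2) \<psi>_append[of w u] v_append[of "[i]" l] v_single[of i] by simp
        ultimately show ?case using w(1) u(1) by (intro bexI[of _ "w @ u"]) auto
      qed
      have pres: "Q (map c u) = Q (map c w)" if "pres_eq S R u w" for u w
        using that
      proof induction
        case (cancel u v s b)
        then have "E (map c [(s, b), (s, \<not> b)]) []" by (auto simp: E_def Fin_def)
        from inv[OF this, of "map c u" "map c v"] show ?case by simp
      next
        case (relator u v r)
        then have "E (map c r) []" by (auto simp: E_def)
        from inv[OF this, of "map c u" "map c v"] show ?case by simp
      qed auto
      obtain u where u: "u \<in> ?W" "\<psi> u = ?v l" "\<And>x. Q (x @ l) = Q (x @ map c u)"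
        using normal_form[of l] by blast
      obtain u' where u': "u' \<in> ?W" "\<psi> u' = ?v l'" "\<And>x. Q (x @ l') = Q (x @ map c u')"
        using normal_form[of l'] by blast
      have "pres_eq S R u u'" using u(2) u'(2) eq \<psi>_eq[OF u(1) u'(1)] by simp
      then show "Q l = Q l'" using pres[of u u'] u(3)[of "[]"] u'(3)[of "[]"] by simp
    qed
  qed (use val_e val_closed in auto)
qed

section \<open>Subshifts given by forbidden pattern codings\<close>

lemma full_shift_eq_topspace:
  "topspace (product_topology (\<lambda>_. discrete_topology A) (carrier K)) = full_shift K A"
  by (simp add: full_shift_def)

lemma shift_avoiding_iff:
  "x \<in> shift_avoiding K A D \<longleftrightarrow> x \<in> full_shift K A \<and>
    (\<forall>g\<in>carrier K. \<forall>c\<in>D. \<exists>(w, a)\<in>c. x (g \<otimes>\<^bsub>K\<^esub> word_value K w) \<noteq> a)"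
  unfolding shift_avoiding_def cylinder_def by (auto split: prod.splits)

lemma openin_cylinder:
  assumes "g \<in> carrier K"
  shows "openin (product_topology (\<lambda>_. discrete_topology A) (carrier K)) (cylinder K A a g)"
proof -
  let ?T = "product_topology (\<lambda>_. discrete_topology A) (carrier K)"
  have "openin ?T {x \<in> topspace ?T. x g \<in> {a} \<inter> A}"
    by (rule openin_continuous_map_preimage[OF continuous_map_product_projection[OF assms]]) simp
  also have "{x \<in> topspace ?T. x g \<in> {a} \<inter> A} = cylinder K A a g"
    using assms unfolding full_shift_eq_topspace cylinder_def full_shift_def by auto
  finally show ?thesis .
qed

text \<open>The complement is a union of finite intersections of cylinders; it is open, and left translation
  permutes the positions at which a coding is forbidden.\<close>

lemma subshift_shift_avoiding:
  assumes "group K" "S \<subseteq> carrier K" "\<And>c. c \<in> D \<Longrightarrow> pattern_coding S A c"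
  shows "subshift K A (shift_avoiding K A D)"
proof -
  interpret group K by fact
  let ?T = "product_topology (\<lambda>_. discrete_topology A) (carrier K)"
  have value_closed: "word_value K w \<in> carrier K" if "(w, a) \<in> c" "c \<in> D" for w a c
    using assms(2) assms(3)[OF that(2)] that(1) unfolding pattern_coding_def
    by (intro word_value_closed) blast
  have open_pattern: "openin ?T ((\<Inter>(w, a)\<in>c. cylinder K A a (g \<otimes>\<^bsub>K\<^esub> word_value K w)) \<inter> topspace ?T)"
    if "g \<in> carrier K" "c \<in> D" for g c
    using assms(3)[OF that(2)] value_closed that
    by (intro openin_INT) (auto simp: pattern_coding_def intro!: openin_cylinder)
  have "openin ?T (\<Union>g\<in>carrier K. \<Union>c\<in>D.
      (\<Inter>(w, a)\<in>c. cylinder K A a (g \<otimes>\<^bsub>K\<^esub> word_value K w)) \<inter> topspace ?T)" (is "openin _ ?O")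
    by (rule openin_Union, erule imageE, hypsubst, rule openin_Union, erule imageE, hypsubst)
      (rule open_pattern)
  moreover have "?O = topspace ?T - shift_avoiding K A D"
    unfolding full_shift_eq_topspace shift_avoiding_def by blast
  ultimately have "closedin ?T (shift_avoiding K A D)"
    unfolding closedin_def full_shift_eq_topspace by (auto simp: shift_avoiding_def)
  moreover have "shift K g x \<in> shift_avoiding K A D"
    if g: "g \<in> carrier K" and x: "x \<in> shift_avoiding K A D" for g x
    unfolding shift_avoiding_iff
  proof (intro conjI ballI)
    show "shift K g x \<in> full_shift K A"
      using g x by (auto simp: shift_avoiding_iff full_shift_def shift_def)
    fix h c assume h: "h \<in> carrier K" and c: "c \<in> D"
    have "inv\<^bsub>K\<^esub> g \<otimes>\<^bsub>K\<^esub> h \<in> carrier K" using g h by simp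
    then obtain w a where wa: "(w, a) \<in> c" "x (inv\<^bsub>K\<^esub> g \<otimes>\<^bsub>K\<^esub> h \<otimes>\<^bsub>K\<^esub> word_value K w) \<noteq> a"
      using x c unfolding shift_avoiding_iff by blast
    with g h value_closed[OF wa(1) c] have "shift K g x (h \<otimes>\<^bsub>K\<^esub> word_value K w) \<noteq> a"
      by (simp add: shift_def m_assoc)
    with wa(1) show "\<exists>(w, a)\<in>c. shift K g x (h \<otimes>\<^bsub>K\<^esub> word_value K w) \<noteq> a" by blast
  qed
  ultimately show ?thesis unfolding subshift_def by blast
qed

section \<open>Configurations as models of clauses\<close>

text \<open>The number of the propositional variable ``the cell reached by \<open>l\<close> has colour \<open>b\<close>''. It is the number
  that the encoding of pattern codings gives to the pair, so a coded pattern coding is a set of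
  variables.\<close>

definition pixel :: "nat list \<Rightarrow> nat \<Rightarrow> nat" where
  "pixel l b = prod_encode (list_encode l, b)"

lemma pixel_eq_iff [simp]: "pixel l b = pixel l' b' \<longleftrightarrow> l = l' \<and> b = b'"
  by (simp add: pixel_def list_encode_eq)

text \<open>The clauses that describe a subshift, in this order: the codings in \<open>M\<close> do not occur in any translate
  (a position is reached by a word \<open>u\<close>, which is prefixed to the words of the coding); each cell has a
  colour; it has only one; and the colour does not change under rewriting along \<open>E\<close>. Letting \<open>p\<close> and
  \<open>q\<close> contain further variables only adds weaker clauses. Words occur through their codes, so that
  the predicate is visibly built from computable operations.\<close>

definition constraint ::
  "nat set \<Rightarrow> nat set \<Rightarrow> (nat list \<Rightarrow> nat list \<Rightarrow> bool) \<Rightarrow> nat \<Rightarrow> nat \<Rightarrow> bool" where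
  "constraint M B E p q \<longleftrightarrow>
     (\<exists>k u. k \<in> M \<and> (\<forall>i\<in>set_decode k.
        pixel (list_decode u @ list_decode (pfst i)) (psnd i) \<in> set_decode p))
   \<or> (\<exists>u. \<forall>b\<in>B. pixel (list_decode u) b \<in> set_decode q)
   \<or> (\<exists>u b b'. b \<in> B \<and> b' \<in> B \<and> b \<noteq> b' \<and>
        pixel (list_decode u) b \<in> set_decode p \<and> pixel (list_decode u) b' \<in> set_decode p)
   \<or> (\<exists>x y l r b. (E (list_decode l) (list_decode r) \<or> E (list_decode r) (list_decode l)) \<and> b \<in> B \<and>
        pixel (list_decode x @ list_decode l @ list_decode y) b \<in> set_decode p \<and>
        pixel (list_decode x @ list_decode r @ list_decode y) b \<in> set_decode q)"

lemma semidecidable_constraint: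
  assumes "re_set M" "finite B" "semidecidable (\<lambda>z. E (list_decode (pfst z)) (list_decode (psnd z)))"
    and "computable f" "computable g"
  shows "semidecidable (\<lambda>x. constraint M B E (f x) (g x))"
proof -
  have E: "semidecidable (\<lambda>x. E (list_decode (f x)) (list_decode (g x)))"
    if "computable f" "computable g" for f g
    using semidecidable_comp[OF assms(3), of "\<lambda>x. prod_encode (f x, g x)"] that
    by (simp add: computable_prod_encode)
  have append: "computable (\<lambda>x. list_encode (list_decode (f x) @ list_decode (g x) @ list_decode (h x)))"
    if "computable f" "computable g" "computable h" for f g h
    using computable_append[OF that(1) computable_append[OF that(2,3)]] by simp
  have list: "computable (\<lambda>x. list_encode (list_decode (f x)))" if "computable f" for f
    using that by simp
  show ?thesis
    unfolding constraint_def pixel_def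
    by (intro semidecidable_disj semidecidable_conj semidecidable_ex semidecidable_ball_finite
        semidecidable_mem_re[OF assms(1)] E
        semidecidable_decidable[OF decidable_ball_set_decode]
        semidecidable_decidable[OF decidable_mem_set_decode]
        semidecidable_decidable[OF decidable_finite_mem]
        semidecidable_decidable[OF decidable_not] decidable_eq
        decidable_mem_set_decode computable_append append list computable_intros
        computable_comp[OF assms(4)] computable_comp[OF assms(5)] assms)
qed

text \<open>Each condition on the right is what the clauses with the least possible \<open>p\<close> and \<open>q\<close> say; the other
  clauses follow from these.\<close>

lemma models_constraint_iff:
  assumes "finite B"
  shows "models Y {(p, q). constraint M B E p q} \<longleftrightarrow>
     (\<forall>k\<in>M. \<forall>u. \<exists>i\<in>set_decode k. pixel (u @ list_decode (pfst i)) (psnd i) \<notin> Y)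
   \<and> (\<forall>u. \<exists>b\<in>B. pixel u b \<in> Y)
   \<and> (\<forall>u. \<forall>b\<in>B. \<forall>b'\<in>B. pixel u b \<in> Y \<longrightarrow> pixel u b' \<in> Y \<longrightarrow> b = b')
   \<and> (\<forall>b\<in>B. rewrite_invariant E (\<lambda>l. pixel l b \<in> Y))"
    (is "?L \<longleftrightarrow> ?R1 \<and> ?R2 \<and> ?R3 \<and> ?R4")
proof
  assume ?L
  then have sat: "set_decode q \<inter> Y \<noteq> {}" if "constraint M B E p q" "set_decode p \<subseteq> Y" for p q
    using that unfolding models_def by blast
  have sat': "Q \<inter> Y \<noteq> {}" if "constraint M B E (set_encode P) (set_encode Q)" "finite P" "finite Q"
    "P \<subseteq> Y" for P Q
    using sat[OF that(1)] that by simp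
  have ?R1
  proof (intro ballI allI)
    fix k u assume "k \<in> M"
    let ?P = "(\<lambda>i. pixel (u @ list_decode (pfst i)) (psnd i)) ` set_decode k"
    have "constraint M B E (set_encode ?P) (set_encode {})"
      unfolding constraint_def using \<open>k \<in> M\<close>
      by (intro disjI1 exI[of _ k] exI[of _ "list_encode u"]) auto
    then show "\<exists>i\<in>set_decode k. pixel (u @ list_decode (pfst i)) (psnd i) \<notin> Y"
      using sat'[of ?P "{}"] by auto
  qed
  moreover have ?R2
  proof
    fix u
    let ?Q = "pixel u ` B"
    have "constraint M B E (set_encode {}) (set_encode ?Q)"
      unfolding constraint_def
      by (rule disjI2, rule disjI1) (use assms in \<open>auto intro!: exI[of _ "list_encode u"]\<close>)
    then show "\<exists>b\<in>B. pixel u b \<in> Y" using sat'[of "{}" ?Q] assms by auto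
  qed
  moreover have ?R3
  proof (intro allI ballI impI)
    fix u b b' assume b: "b \<in> B" "b' \<in> B" "pixel u b \<in> Y" "pixel u b' \<in> Y"
    show "b = b'"
    proof (rule ccontr)
      assume "b \<noteq> b'"
      have dec: "set_decode (set_encode {pixel u b, pixel u b'}) = {pixel u b, pixel u b'}"
        by (rule set_encode_inverse) simp
      have "constraint M B E (set_encode {pixel u b, pixel u b'}) (set_encode {})"
        unfolding constraint_def dec
        by (rule disjI2, rule disjI2, rule disjI1, rule exI[of _ "list_encode u"],
            rule exI[of _ b], rule exI[of _ b']) (use b(1,2) \<open>b \<noteq> b'\<close> in simp)
      then show False using sat'[of "{pixel u b, pixel u b'}" "{}"] b by auto
    qed
  qed
  moreover have ?R4
    unfolding rewrite_invariant_def
  proof (intro allI ballI impI)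
    fix x y l r b assume b: "b \<in> B" and E: "E l r"
    have "pixel (x @ r' @ y) b \<in> Y" if "E l' r' \<or> E r' l'" "pixel (x @ l' @ y) b \<in> Y" for l' r'
    proof -
      have dec: "set_decode (set_encode {i}) = {i}" for i
        by (rule set_encode_inverse) simp
      have "constraint M B E (set_encode {pixel (x @ l' @ y) b}) (set_encode {pixel (x @ r' @ y) b})"
        unfolding constraint_def dec
        by (rule disjI2, rule disjI2, rule disjI2, rule exI[of _ "list_encode x"],
            rule exI[of _ "list_encode y"], rule exI[of _ "list_encode l'"],
            rule exI[of _ "list_encode r'"], rule exI[of _ b]) (use b that(1) in simp)
      then show ?thesis using sat'[of "{pixel (x @ l' @ y) b}" "{pixel (x @ r' @ y) b}"] that(2) by auto
    qed
    then show "pixel (x @ l @ y) b \<in> Y \<longleftrightarrow> pixel (x @ r @ y) b \<in> Y" using E by blast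
  qed
  ultimately show "?R1 \<and> ?R2 \<and> ?R3 \<and> ?R4" by blast
next
  assume R: "?R1 \<and> ?R2 \<and> ?R3 \<and> ?R4"
  show ?L
    unfolding models_def
  proof (clarify)
    fix p q assume c: "constraint M B E p q" and p: "set_decode p \<subseteq> Y" and q: "set_decode q \<inter> Y = {}"
    from c consider
        k u where "k \<in> M" "\<forall>i\<in>set_decode k. pixel (list_decode u @ list_decode (pfst i)) (psnd i) \<in> set_decode p"
      | u where "\<forall>b\<in>B. pixel (list_decode u) b \<in> set_decode q"
      | u b b' where "b \<in> B" "b' \<in> B" "b \<noteq> b'"
        "pixel (list_decode u) b \<in> set_decode p" "pixel (list_decode u) b' \<in> set_decode p"
      | x y l r b where "E (list_decode l) (list_decode r) \<or> E (list_decode r) (list_decode l)" "b \<in> B"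
        "pixel (list_decode x @ list_decode l @ list_decode y) b \<in> set_decode p"
        "pixel (list_decode x @ list_decode r @ list_decode y) b \<in> set_decode q"
      unfolding constraint_def by blast
    then show False
    proof cases
      case 1
      then show False using R p by blast
    next
      case 2
      then show False using R q by blast
    next
      case 3
      then show False using R p by blast
    next
      case 4
      then have "pixel (list_decode x @ list_decode l @ list_decode y) b \<in> Y"
        "pixel (list_decode x @ list_decode r @ list_decode y) b \<notin> Y" using p q by auto
      then show False using R 4(1,2) unfolding rewrite_invariant_def by blast
    qed
  qed
qed

definition pair_code :: "('g \<Rightarrow> nat) \<Rightarrow> ('a \<Rightarrow> nat) \<Rightarrow> 'g list \<times> 'a \<Rightarrow> nat" where
  "pair_code e d = (\<lambda>(w, a). pixel (map e w) (d a))"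

lemma pair_code_image_iff:
  "i \<in> pair_code e d ` (lists T \<times> A) \<longleftrightarrow> list_decode (pfst i) \<in> lists (e ` T) \<and> psnd i \<in> d ` A"
proof -
  have "i = pixel (list_decode (pfst i)) (psnd i)" by (simp add: pixel_def)
  then obtain l b where i: "i = pixel l b" by blast
  have "i \<in> pair_code e d ` (lists T \<times> A) \<longleftrightarrow> l \<in> map e ` lists T \<and> b \<in> d ` A"
    by (auto simp: pair_code_def i image_iff)
  then show ?thesis by (simp add: i pixel_def lists_image)
qed

text \<open>Soundness of the clauses: the variables that are true in a configuration form a model.\<close>

lemma constraint_model_of_configuration:
  fixes G :: "('g, 'm) monoid_scheme"
  assumes "group G" "finite A" "inj_on d A"
    and codings: "\<And>c. c \<in> C \<Longrightarrow> pattern_coding U A c"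
    and val: "\<And>u. u \<in> U \<Longrightarrow> val (e u) = u" "\<And>i. val i \<in> carrier G"
    and sound: "\<And>l r. E l r \<Longrightarrow> word_value G (map val l) = word_value G (map val r)"
    and y: "y \<in> shift_avoiding G A C"
  shows "models {pixel l (d (y (word_value G (map val l)))) | l. True}
    {(p, q). constraint ((\<lambda>c. set_encode (pair_code e d ` c)) ` C) (d ` A) E p q}" (is "models ?Y _")
proof -
  interpret group G by fact
  let ?v = "\<lambda>l. word_value G (map val l)"
  have v_closed: "?v l \<in> carrier G" for l
    by (intro word_value_closed) (auto simp: val)
  have v_append: "?v (l @ r) = ?v l \<otimes>\<^bsub>G\<^esub> ?v r" for l r
    unfolding map_append by (intro word_value_append) (auto simp: val)
  have in_Y: "pixel l b \<in> ?Y \<longleftrightarrow> b = d (y (?v l))" for l b by auto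
  have yA: "y (?v l) \<in> A" for l
    using y v_closed[of l] unfolding shift_avoiding_iff full_shift_def by auto
  show ?thesis
    unfolding models_constraint_iff[OF finite_imageI[OF assms(2)]] rewrite_invariant_def in_Y
  proof (intro conjI ballI allI impI)
    fix k u assume "k \<in> (\<lambda>c. set_encode (pair_code e d ` c)) ` C"
    then obtain c where c: "c \<in> C" "k = set_encode (pair_code e d ` c)" by blast
    have pc: "finite c" "c \<subseteq> lists U \<times> A" using codings[OF c(1)] by (auto simp: pattern_coding_def)
    obtain w a where wa: "(w, a) \<in> c" "y (?v u \<otimes>\<^bsub>G\<^esub> word_value G w) \<noteq> a"
      using y c(1) v_closed[of u] unfolding shift_avoiding_iff by blast
    have w: "map (\<lambda>s. val (e s)) w = w"
      using wa(1) pc(2) val(1) by (intro map_idI) auto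
    have "pair_code e d (w, a) \<in> set_decode k" using wa(1) pc(1) c(2) by simp
    moreover have "psnd (pair_code e d (w, a))
        \<noteq> d (y (?v (u @ list_decode (pfst (pair_code e d (w, a))))))"
    proof
      assume "psnd (pair_code e d (w, a)) = d (y (?v (u @ list_decode (pfst (pair_code e d (w, a))))))"
      then have "d a = d (y (?v (u @ map e w)))" by (simp add: pair_code_def pixel_def)
      moreover have "a \<in> A" using wa(1) pc(2) by auto
      ultimately have "a = y (?v (u @ map e w))" by (rule inj_onD[OF assms(3)]) (rule yA)
      also have "?v (u @ map e w) = ?v u \<otimes>\<^bsub>G\<^esub> word_value G w"
        unfolding v_append by (simp add: comp_def w)
      finally show False using wa(2) by simp
    qed
    ultimately show "\<exists>i\<in>set_decode k. psnd i \<noteq> d (y (?v (u @ list_decode (pfst i))))" by blast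
  next
    show "\<exists>b\<in>d ` A. b = d (y (?v u))" for u using yA by blast
  next
    fix x z l r b assume "E l r"
    then show "(b = d (y (?v (x @ l @ z)))) = (b = d (y (?v (x @ r @ z))))"
      by (simp add: v_append sound del: map_append)
  qed auto
qed

text \<open>Completeness of the clauses: in a model every word has one colour, and the set of words of a given colour
  is invariant under rewriting. So the colour of a word depends on its value only and defines a
  configuration.\<close>

lemma configuration_of_constraint_model:
  fixes G :: "('g, 'm) monoid_scheme"
  assumes "group G" "finite A" "inj_on d A"
    and surj: "\<And>g. g \<in> carrier G \<Longrightarrow> \<exists>w\<in>lists U. word_value G w = g"
    and codings: "\<And>c. c \<in> C \<Longrightarrow> pattern_coding U A c"
    and val: "\<And>u. u \<in> U \<Longrightarrow> val (e u) = u" "\<And>i. val i \<in> carrier G"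
    and complete: "\<forall>Q l l'. rewrite_invariant E Q \<longrightarrow>
          word_value G (map val l) = word_value G (map val l') \<longrightarrow> Q l = Q l'"
    and Y: "models Y {(p, q). constraint ((\<lambda>c. set_encode (pair_code e d ` c)) ` C) (d ` A) E p q}"
  obtains y where "y \<in> shift_avoiding G A C"
    and "\<And>l a. a \<in> A \<Longrightarrow> pixel l (d a) \<in> Y \<longleftrightarrow> y (word_value G (map val l)) = a"
proof -
  interpret group G by fact
  let ?v = "\<lambda>l. word_value G (map val l)"
  have v_closed: "?v l \<in> carrier G" for l
    by (intro word_value_closed) (auto simp: val)
  have v_append: "?v (l @ r) = ?v l \<otimes>\<^bsub>G\<^esub> ?v r" for l r
    unfolding map_append by (intro word_value_append) (auto simp: val)
  have v_map: "?v (map e w) = word_value G w" if "w \<in> lists U" for w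
  proof -
    have "map (\<lambda>s. val (e s)) w = w" using that val(1) by (intro map_idI) auto
    then show ?thesis by (simp add: comp_def)
  qed
  note R = models_constraint_iff[OF finite_imageI[OF assms(2)], THEN iffD1, OF Y]
  note avoids = R[THEN conjunct1] and coloured = R[THEN conjunct2, THEN conjunct1]
    and unique = R[THEN conjunct2, THEN conjunct2, THEN conjunct1]
    and invariant = R[THEN conjunct2, THEN conjunct2, THEN conjunct2]
  have "\<exists>a\<in>A. pixel l (d a) \<in> Y" for l using coloured[THEN spec, of l] by blast
  then obtain colour where colour: "\<And>l. colour l \<in> A" "\<And>l. pixel l (d (colour l)) \<in> Y" by metis
  have in_Y: "pixel l (d a) \<in> Y \<longleftrightarrow> colour l = a" if "a \<in> A" for l a
    using unique[rule_format, of "d (colour l)" "d a" l] colour[of l] that inj_onD[OF assms(3)]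
    by blast
  have colour_cong: "colour l = colour l'" if "?v l = ?v l'" for l l'
  proof -
    have "(pixel l (d (colour l')) \<in> Y) = (pixel l' (d (colour l')) \<in> Y)"
      using complete[THEN spec[of _ "\<lambda>l. pixel l (d (colour l')) \<in> Y"]] invariant colour(1)[of l'] that
      by blast
    then show ?thesis using in_Y[OF colour(1)[of l'], of l] colour(2)[of l'] by simp
  qed
  \<comment> \<open>the colour of \<open>g\<close> is the colour of any word with value \<open>g\<close>\<close>
  define y where "y = (\<lambda>g\<in>carrier G. colour (SOME l. ?v l = g))"
  have y: "y (?v l) = colour l" for l
  proof -
    have "?v (SOME l'. ?v l' = ?v l) = ?v l" by (rule someI[of "\<lambda>l'. ?v l' = ?v l"]) simp
    from colour_cong[OF this] show ?thesis using v_closed[of l] by (simp add: y_def)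
  qed
  show thesis
  proof (rule that)
    show "pixel l (d a) \<in> Y \<longleftrightarrow> y (?v l) = a" if "a \<in> A" for l a
      using in_Y[OF that] y by simp
    show "y \<in> shift_avoiding G A C"
      unfolding shift_avoiding_iff
    proof (intro conjI ballI)
      show "y \<in> full_shift G A" by (auto simp: y_def full_shift_def colour)
      fix g c assume g: "g \<in> carrier G" and c: "c \<in> C"
      have pc: "finite c" "c \<subseteq> lists U \<times> A" using codings[OF c] by (auto simp: pattern_coding_def)
      obtain u where u: "u \<in> lists U" "word_value G u = g" using surj[OF g] by blast
      have "\<exists>i\<in>set_decode (set_encode (pair_code e d ` c)).
          pixel (map e u @ list_decode (pfst i)) (psnd i) \<notin> Y"
        using avoids c by blast
      then obtain w a where wa: "(w, a) \<in> c" "pixel (map e u @ map e w) (d a) \<notin> Y"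
        using pc(1) by (auto simp: pair_code_def pixel_def)
      have "a \<in> A" using wa(1) pc(2) by blast
      then have "y (?v (map e u @ map e w)) \<noteq> a"
        unfolding y using in_Y[of a "map e u @ map e w"] wa(2) by simp
      moreover have "?v (map e u @ map e w) = g \<otimes>\<^bsub>G\<^esub> word_value G w"
        unfolding v_append using u wa(1) pc(2) by (subst (1 2) v_map) auto
      ultimately show "\<exists>(w, a)\<in>c. y (g \<otimes>\<^bsub>G\<^esub> word_value G w) \<noteq> a" using wa(1) by auto
    qed
  qed
qed

text \<open>Here \<open>c\<close> may be infinite. Finite \<open>c\<close> matter for enumerability, infinite ones for
  compactness.\<close>

theorem pattern_extension_as_satisfiability:
  fixes G :: "('g, 'm) monoid_scheme"
  assumes "group G" "recursively_presented G" "finite A" "inj_on d A"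
    and "finite U" "U \<subseteq> carrier G" "inj_on e U"
    and surj: "\<And>g. g \<in> carrier G \<Longrightarrow> \<exists>w\<in>lists U. word_value G w = g"
    and codings: "\<And>c. c \<in> C \<Longrightarrow> pattern_coding U A c"
    and re: "re_set ((\<lambda>c. set_encode (pair_code e d ` c)) ` C)"
  obtains P where
    "\<And>f g. computable f \<Longrightarrow> computable g \<Longrightarrow> semidecidable (\<lambda>x. P (f x) (g x))"
    and "\<And>c. c \<subseteq> lists U \<times> A \<Longrightarrow>
      (\<exists>y\<in>shift_avoiding G A C. \<forall>(w, a)\<in>c. y (word_value G w) = a) \<longleftrightarrow>
      (\<exists>Y. models Y {(p, q). P p q} \<and> pair_code e d ` c \<subseteq> Y)"
proof -
  obtain val :: "nat \<Rightarrow> 'g" and E :: "nat list \<Rightarrow> nat list \<Rightarrow> bool"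
    where val: "\<And>u. u \<in> U \<Longrightarrow> val (e u) = u" "\<And>i. val i \<in> carrier G"
    and E: "semidecidable (\<lambda>z. E (list_decode (pfst z)) (list_decode (psnd z)))"
    and sound: "\<And>l r. E l r \<Longrightarrow> word_value G (map val l) = word_value G (map val r)"
    and complete: "\<forall>Q l l'. rewrite_invariant E Q \<longrightarrow>
          word_value G (map val l) = word_value G (map val l') \<longrightarrow> Q l = Q l'"
    by (rule recursively_enumerable_rewriting[OF assms(1,2,5,6,7)]) (rule that)
  let ?v = "\<lambda>l. word_value G (map val l)"
  let ?P = "constraint ((\<lambda>c. set_encode (pair_code e d ` c)) ` C) (d ` A) E"
  have v_map: "?v (map e w) = word_value G w" if "w \<in> lists U" for w
  proof -
    have "map (\<lambda>s. val (e s)) w = w" using that val(1) by (intro map_idI) auto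
    then show ?thesis by (simp add: comp_def)
  qed
  show thesis
  proof (rule that[of ?P])
    show "semidecidable (\<lambda>x. ?P (f x) (g x))" if "computable f" "computable g" for f g
      using semidecidable_constraint[OF re finite_imageI[OF assms(3)] E that] .
    fix c assume c: "c \<subseteq> lists U \<times> A"
    show "(\<exists>y\<in>shift_avoiding G A C. \<forall>(w, a)\<in>c. y (word_value G w) = a) \<longleftrightarrow>
      (\<exists>Y. models Y {(p, q). ?P p q} \<and> pair_code e d ` c \<subseteq> Y)"
    proof
      assume "\<exists>y\<in>shift_avoiding G A C. \<forall>(w, a)\<in>c. y (word_value G w) = a"
      then obtain y where y: "y \<in> shift_avoiding G A C" "\<And>w a. (w, a) \<in> c \<Longrightarrow> y (word_value G w) = a"
        by fastforce
      have "pair_code e d ` c \<subseteq> {pixel l (d (y (?v l))) | l. True}"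
        using c y(2) v_map by (fastforce simp: pair_code_def)
      then show "\<exists>Y. models Y {(p, q). ?P p q} \<and> pair_code e d ` c \<subseteq> Y"
        using constraint_model_of_configuration[OF assms(1,3,4) codings val sound y(1)] by blast
    next
      assume "\<exists>Y. models Y {(p, q). ?P p q} \<and> pair_code e d ` c \<subseteq> Y"
      then obtain Y where Y: "models Y {(p, q). ?P p q}" "pair_code e d ` c \<subseteq> Y" by blast
      obtain y where y: "y \<in> shift_avoiding G A C"
        "\<And>l a. a \<in> A \<Longrightarrow> pixel l (d a) \<in> Y \<longleftrightarrow> y (?v l) = a"
        by (rule configuration_of_constraint_model[OF assms(1,3,4) surj codings val complete Y(1)])
          (assumption | rule that)+
      have "y (word_value G w) = a" if "(w, a) \<in> c" for w a
      proof -
        have "pixel (map e w) (d a) \<in> Y" using Y(2) that by (force simp: pair_code_def)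
        moreover have "w \<in> lists U" "a \<in> A" using c that by blast+
        ultimately show ?thesis using y(2)[of a "map e w"] v_map[of w] by simp
      qed
      then show "\<exists>y\<in>shift_avoiding G A C. \<forall>(w, a)\<in>c. y (word_value G w) = a"
        using y(1) by (intro bexI[of _ y]) auto
    qed
  qed
qed

section \<open>Projective subdynamics\<close>

text \<open>The numbering of \<open>S\<close> comes with the enumeration of the forbidden codings and must be kept; only the new
  generators are free to be numbered.\<close>

lemma extend_inj_on:
  fixes e :: "'a \<Rightarrow> nat"
  assumes "finite U" "S \<subseteq> U" "inj_on e S"
  obtains e' where "inj_on e' U" "\<And>s. s \<in> S \<Longrightarrow> e' s = e s"
proof -
  have "finite (e ` S)" using assms(1,2) finite_subset by blast
  then obtain K where K: "\<And>s. s \<in> S \<Longrightarrow> e s < K"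
    using finite_nat_set_iff_bounded[of "e ` S"] by auto
  obtain h :: "'a \<Rightarrow> nat" where h: "inj_on h U"
    using finite_imp_inj_to_nat_seg[OF assms(1)] by blast
  show thesis
  proof
    let ?e = "\<lambda>u. if u \<in> S then e u else K + h u"
    show "inj_on ?e U"
    proof (rule inj_onI)
      fix u v assume "u \<in> U" "v \<in> U" "?e u = ?e v"
      then show "u = v"
        using K[of u] K[of v] assms(3) h by (auto split: if_splits dest: inj_onD)
    qed
  qed simp
qed

text \<open>A number codes a pattern coding over \<open>T\<close> iff the elements of the coded set have the right shape, which is
  decidable; and unsatisfiability is semidecidable.\<close>

lemma re_codings_inconsistent:
  assumes "finite A" "inj_on d A" "finite U" "inj_on e U" "T \<subseteq> U"
    and P: "\<And>f g. computable f \<Longrightarrow> computable g \<Longrightarrow> semidecidable (\<lambda>x. P (f x) (g x))"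
  shows "re_codings T A {c. pattern_coding T A c \<and>
    \<not> (\<exists>Y. models Y {(p, q). P p q} \<and> pair_code e d ` c \<subseteq> Y)}" (is "re_codings T A ?D")
proof -
  have pair_code: "pair_code e d = (\<lambda>(w, a). prod_encode (list_encode (map e w), d a))"
    by (simp add: pair_code_def pixel_def)
  let ?N = "(\<lambda>c. set_encode (pair_code e d ` c)) ` ?D"
  let ?valid = "\<lambda>n. \<forall>i\<in>set_decode n. list_decode (pfst i) \<in> lists (e ` T) \<and> psnd i \<in> d ` A"
  let ?unsat = "\<lambda>n. \<not> (\<exists>Y. models Y {(p, q). P p q \<or> (\<exists>i\<in>set_decode n. i \<in> set_decode q)})"
  have "n \<in> ?N \<longleftrightarrow> ?valid n \<and> ?unsat n" for n
  proof -
    have valid: "?valid n \<longleftrightarrow> set_decode n \<subseteq> pair_code e d ` (lists T \<times> A)"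
      unfolding subset_iff pair_code_image_iff by blast
    have unsat: "?unsat n \<longleftrightarrow> \<not> (\<exists>Y. models Y {(p, q). P p q} \<and> set_decode n \<subseteq> Y)"
      by (simp only: models_with_units)
    show ?thesis
      unfolding valid unsat
    proof
      assume "n \<in> ?N"
      then obtain c where c: "pattern_coding T A c" "n = set_encode (pair_code e d ` c)"
        "\<not> (\<exists>Y. models Y {(p, q). P p q} \<and> pair_code e d ` c \<subseteq> Y)" by blast
      then have n: "set_decode n = pair_code e d ` c" by (simp add: pattern_coding_def)
      show "set_decode n \<subseteq> pair_code e d ` (lists T \<times> A) \<and>
          \<not> (\<exists>Y. models Y {(p, q). P p q} \<and> set_decode n \<subseteq> Y)"
        using c(1,3) unfolding n pattern_coding_def by (simp add: image_mono)
    next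
      assume n: "set_decode n \<subseteq> pair_code e d ` (lists T \<times> A) \<and>
        \<not> (\<exists>Y. models Y {(p, q). P p q} \<and> set_decode n \<subseteq> Y)"
      then obtain c where c: "c \<subseteq> lists T \<times> A" "finite c" "set_decode n = pair_code e d ` c"
        using finite_subset_image[of "set_decode n"] finite_set_decode by metis
      have "n = set_encode (pair_code e d ` c)" using c(3) by (metis set_decode_inverse)
      moreover have "c \<in> ?D"
        using n c by (simp add: pattern_coding_def)
      ultimately show "n \<in> ?N" by (rule image_eqI)
    qed
  qed
  moreover have "semidecidable (\<lambda>n. ?valid n \<and> ?unsat n)"
    by (intro semidecidable_conj semidecidable_decidable[OF decidable_ball_set_decode]
        decidable_conj decidable_lists decidable_finite_mem finite_imageI assms(1)
        finite_subset[OF assms(5,3)] semidecidable_unsatisfiable semidecidable_disj P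
        semidecidable_decidable[OF decidable_bex_set_decode] decidable_mem_set_decode
        computable_intros)
  ultimately have "re_set ?N" unfolding re_set_iff_semidecidable by simp
  moreover have "inj_on e T" using assms(4,5) inj_on_subset by blast
  ultimately show ?thesis
    unfolding re_codings_def pair_code using assms(2) by blast
qed

text \<open>The hypothesis \<open>compact\<close> is compactness of \<open>X\<close>, restricted to the cells of \<open>H\<close>. An element \<open>x\<close>
  that avoids the unrealisable codings is itself an infinite pattern all of whose finite parts are
  realised; each element of \<open>H\<close> is the value of a word over \<open>T\<close>, so the pattern prescribes \<open>x\<close>
  everywhere.\<close>

lemma proj_subdynamics_eq_shift_avoiding:
  fixes G :: "('g, 'm) monoid_scheme"
  assumes "group G" "subgroup H G" "fin_gen_set (G\<lparr>carrier := H\<rparr>) T" "subshift G A X"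
    and compact: "\<And>c. c \<subseteq> lists T \<times> A \<Longrightarrow>
      (\<And>c'. finite c' \<Longrightarrow> c' \<subseteq> c \<Longrightarrow> \<exists>y\<in>X. \<forall>(w, a)\<in>c'. y (word_value G w) = a) \<Longrightarrow>
      \<exists>y\<in>X. \<forall>(w, a)\<in>c. y (word_value G w) = a"
  shows "proj_subdynamics H A X = shift_avoiding (G\<lparr>carrier := H\<rparr>) A
    {c. pattern_coding T A c \<and> \<not> (\<exists>y\<in>X. \<forall>(w, a)\<in>c. y (word_value G w) = a)}"
    (is "_ = shift_avoiding ?H A ?D")
proof -
  interpret group G by fact
  interpret H: subgroup H G by fact
  have groupH: "group ?H" using assms(2) by (rule subgroup_imp_group)
  have valueH: "word_value ?H w = word_value G w" for w by (simp add: word_value_def)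
  have T: "T \<subseteq> H" using assms(3) by (simp add: fin_gen_set_def)
  have value_in_H: "word_value G w \<in> H" if "w \<in> lists T" for w
    using monoid.word_value_closed[OF group.is_monoid[OF groupH], of w] that T
    by (auto simp: valueH)
  have X: "shift G g y \<in> X" if "g \<in> carrier G" "y \<in> X" for g y
    using assms(4) that unfolding subshift_def by blast
  have avoid: "x \<in> shift_avoiding ?H A ?D \<longleftrightarrow> x \<in> H \<rightarrow>\<^sub>E A \<and>
      (\<forall>g\<in>H. \<forall>c\<in>?D. \<exists>(w, a)\<in>c. x (g \<otimes>\<^bsub>G\<^esub> word_value G w) \<noteq> a)" for x
    unfolding shift_avoiding_iff valueH by (simp add: full_shift_def)
  show ?thesis
  proof (intro equalityI subsetI)
    fix x assume "x \<in> proj_subdynamics H A X"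
    then obtain y where x: "x \<in> H \<rightarrow>\<^sub>E A" and y: "y \<in> X" "\<And>h. h \<in> H \<Longrightarrow> x h = y h"
      unfolding proj_subdynamics_def by blast
    have "\<exists>(w, a)\<in>c. x (g \<otimes>\<^bsub>G\<^esub> word_value G w) \<noteq> a" if g: "g \<in> H" and c: "c \<in> ?D" for g c
    proof (rule ccontr)
      assume no: "\<not> (\<exists>(w, a)\<in>c. x (g \<otimes>\<^bsub>G\<^esub> word_value G w) \<noteq> a)"
      \<comment> \<open>an occurrence of \<open>c\<close> at \<open>g\<close> is moved to the identity by shifting \<open>y\<close>\<close>
      have "shift G (inv\<^bsub>G\<^esub> g) y (word_value G w) = a" if wa: "(w, a) \<in> c" for w a
      proof -
        have w: "word_value G w \<in> H"
          using wa c value_in_H unfolding pattern_coding_def by blast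
        then have "shift G (inv\<^bsub>G\<^esub> g) y (word_value G w) = x (g \<otimes>\<^bsub>G\<^esub> word_value G w)"
          using g y(2) by (simp add: shift_def)
        then show ?thesis using no wa by auto
      qed
      moreover have "shift G (inv\<^bsub>G\<^esub> g) y \<in> X" using X y(1) g by simp
      ultimately show False using c by fastforce
    qed
    then show "x \<in> shift_avoiding ?H A ?D" using x unfolding avoid by blast
  next
    fix x assume x: "x \<in> shift_avoiding ?H A ?D"
    then have xA: "x \<in> H \<rightarrow>\<^sub>E A" unfolding avoid by blast
    let ?c = "(\<lambda>w. (w, x (word_value G w))) ` lists T"
    have c: "?c \<subseteq> lists T \<times> A" using xA value_in_H by auto
    have "\<exists>y\<in>X. \<forall>(w, a)\<in>?c. y (word_value G w) = a"
    proof (rule compact[OF c], rule ccontr)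
      fix c' assume c': "finite c'" "c' \<subseteq> ?c"
        and no: "\<not> (\<exists>y\<in>X. \<forall>(w, a)\<in>c'. y (word_value G w) = a)"
      have "c' \<subseteq> lists T \<times> A" using c c'(2) by (rule order_trans[rotated])
      then have "c' \<in> ?D" using c'(1) no by (simp add: pattern_coding_def)
      from x[unfolded avoid, THEN conjunct2, THEN bspec, OF H.one_closed, THEN bspec, OF this]
      obtain w a where wa: "(w, a) \<in> c'" "x (\<one>\<^bsub>G\<^esub> \<otimes>\<^bsub>G\<^esub> word_value G w) \<noteq> a"
        by blast
      then have "w \<in> lists T" "a = x (word_value G w)" using c'(2) by auto
      then show False using wa(2) value_in_H[of w] by simp
    qed
    then obtain y where y: "y \<in> X" "\<And>w. w \<in> lists T \<Longrightarrow> y (word_value G w) = x (word_value G w)"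
      by auto
    have "x h = y h" if h: "h \<in> H" for h
    proof -
      obtain w where w: "w \<in> lists T" "word_value ?H w = h"
        using word_value_surj[OF groupH assms(3), of h] h by auto
      then show ?thesis using y(2)[OF w(1)] by (simp add: valueH)
    qed
    then show "x \<in> proj_subdynamics H A X"
      using xA y(1) unfolding proj_subdynamics_def by blast
  qed
qed

theorem proposition2p9:
  fixes G :: "('g, 'm) monoid_scheme"
    and S H T :: "'g set" and A :: "'a set" and X :: "('g \<Rightarrow> 'a) set"
  assumes "group G" and "fin_gen_set G S" and "recursively_presented G"
    and "subgroup H G" and "fin_gen_set (G\<lparr>carrier := H\<rparr>) T"
    and "finite A"
    and "subshift G A X" and "effectively_closed G S A X"
  shows "subshift (G\<lparr>carrier := H\<rparr>) A (proj_subdynamics H A X)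
    \<and> effectively_closed (G\<lparr>carrier := H\<rparr>) T A (proj_subdynamics H A X)"
proof -
  let ?H = "G\<lparr>carrier := H\<rparr>"
  have groupH: "group ?H" using assms(1,4) by (intro group.subgroup_imp_group)
  have S: "finite S" "S \<subseteq> carrier G" and T: "finite T" "T \<subseteq> H" "T \<subseteq> carrier G"
    using assms(2,5) subgroup.subset[OF assms(4)] by (auto simp: fin_gen_set_def)
  let ?U = "S \<union> T"
  obtain C where C: "re_codings S A C" and X: "X = shift_avoiding G A C"
    using assms(8) unfolding effectively_closed_def by blast
  then obtain e0 d where coding: "\<And>c. c \<in> C \<Longrightarrow> pattern_coding S A c"
    and e0: "inj_on e0 S" and d: "inj_on d A"
    and re0: "re_set ((\<lambda>c. set_encode (pair_code e0 d ` c)) ` C)"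
    unfolding re_codings_def pair_code_def pixel_def by blast
  obtain e where e: "inj_on e ?U" "\<And>s. s \<in> S \<Longrightarrow> e s = e0 s"
    using extend_inj_on[of ?U S e0] S(1) T(1) e0 by auto
  have "pair_code e d ` c = pair_code e0 d ` c" if "c \<in> C" for c
    using coding[OF that] e(2) unfolding pattern_coding_def pair_code_def
    by (intro image_cong) (auto intro!: map_cong)
  then have re: "re_set ((\<lambda>c. set_encode (pair_code e d ` c)) ` C)"
    using re0 by (simp cong: image_cong)
  have codingU: "pattern_coding ?U A c" if "c \<in> C" for c
    using coding[OF that] lists_mono[of S ?U] unfolding pattern_coding_def by blast
  have surj: "\<exists>w\<in>lists ?U. word_value G w = g" if g: "g \<in> carrier G" for g
  proof -
    obtain w where "w \<in> lists S" "word_value G w = g" by (rule word_value_surj[OF assms(1,2) g])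
    then show ?thesis by (intro bexI[of _ w]) auto
  qed
  have U: "finite ?U" "?U \<subseteq> carrier G" using S T by auto
  obtain P where P: "\<And>f g. computable f \<Longrightarrow> computable g \<Longrightarrow> semidecidable (\<lambda>x. P (f x) (g x))"
    and extension: "\<And>c. c \<subseteq> lists ?U \<times> A \<Longrightarrow>
      (\<exists>y\<in>shift_avoiding G A C. \<forall>(w, a)\<in>c. y (word_value G w) = a) \<longleftrightarrow>
      (\<exists>Y. models Y {(p, q). P p q} \<and> pair_code e d ` c \<subseteq> Y)"
    by (rule pattern_extension_as_satisfiability[OF assms(1,3,6) d U e(1) surj codingU re])
      (assumption | rule that)+
  have TU: "lists T \<times> A \<subseteq> lists ?U \<times> A" using lists_mono[of T ?U] by blast
  have compact: "\<exists>y\<in>X. \<forall>(w, a)\<in>c. y (word_value G w) = a"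
    if c: "c \<subseteq> lists T \<times> A"
      and fin: "\<And>c'. finite c' \<Longrightarrow> c' \<subseteq> c \<Longrightarrow> \<exists>y\<in>X. \<forall>(w, a)\<in>c'. y (word_value G w) = a" for c
  proof -
    have "\<exists>Y. models Y {(p, q). P p q} \<and> pair_code e d ` c \<subseteq> Y"
    proof (rule models_units_compactness)
      fix J assume "finite J" "J \<subseteq> pair_code e d ` c"
      then obtain c' where c': "c' \<subseteq> c" "finite c'" "J = pair_code e d ` c'"
        using finite_subset_image by metis
      have "c' \<subseteq> lists ?U \<times> A" using c c'(1) TU by blast
      then show "\<exists>Y. models Y {(p, q). P p q} \<and> J \<subseteq> Y"
        unfolding c'(3) using extension fin[OF c'(2,1)] unfolding X by blast
    qed
    moreover have "c \<subseteq> lists ?U \<times> A" using c TU by blast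
    ultimately show ?thesis unfolding X using extension by blast
  qed
  let ?D = "{c. pattern_coding T A c \<and> \<not> (\<exists>y\<in>X. \<forall>(w, a)\<in>c. y (word_value G w) = a)}"
  have proj_eq: "proj_subdynamics H A X = shift_avoiding ?H A ?D"
    by (rule proj_subdynamics_eq_shift_avoiding[OF assms(1,4,5,7) compact])
  have "?D = {c. pattern_coding T A c \<and> \<not> (\<exists>Y. models Y {(p, q). P p q} \<and> pair_code e d ` c \<subseteq> Y)}"
  proof (intro Collect_cong conj_cong HOL.refl arg_cong[where f = Not])
    fix c assume "pattern_coding T A c"
    then have "c \<subseteq> lists ?U \<times> A" using TU by (auto simp: pattern_coding_def)
    then show "(\<exists>y\<in>X. \<forall>(w, a)\<in>c. y (word_value G w) = a) \<longleftrightarrow>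
        (\<exists>Y. models Y {(p, q). P p q} \<and> pair_code e d ` c \<subseteq> Y)"
      unfolding X by (rule extension)
  qed
  also have "re_codings T A \<dots>"
    by (rule re_codings_inconsistent[OF assms(6) d _ e(1) _ P]) (use S T in auto)
  finally have "re_codings T A ?D" .
  moreover have "subshift ?H A (shift_avoiding ?H A ?D)"
    by (rule subshift_shift_avoiding[OF groupH, of T]) (use T in auto)
  ultimately show ?thesis unfolding effectively_closed_def proj_eq by blast
qed

end
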